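(* Let $\kappa>0$, $0<p<1$, $T_p\sim\mathrm{NB}(\kappa,p)$ and $W_p:=pT_p$. Then $$d_{\mathrm W}(\mathscr{L}(W_p),\Gamma(\kappa(1-p),1))\le4\sqrt{\frac{6\kappa(1-p)p}{\kappa(1-p)+2}}+\frac{4\kappa(1-p)p}{\kappa(1-p)+2},$$ $$d_{\mathrm K}(\mathscr{L}(W_p),\Gamma(\kappa(1-p),1))\le a_{r,\alpha}(0.5p)^{\frac{r\wedge1}{r\wedge1+2}}+b_{r,\alpha}(0.5p)^{\frac{r\wedge1+1}{r\wedge1+2}},$$ where $r=\mu=\kappa(1-p)$, $\alpha=1$, and $$a_{r,\alpha}=\begin{cases}\left(\frac12+\frac1r\right)\left(\frac{48\mu}{r+2}\right)^{\frac{r}{r+2}}\left[\frac{\alpha^r}{\Gamma(r)}\right]^{\frac{2}{r+2}},&0<r<1,\\[4pt] 3\left(\frac{6\mu}{r+2}\right)^{1/3}\left[\frac{\alpha}{\Gamma(r)}\left(\frac{r-1}{e}\right)^{r-1}\right]^{2/3},&r\ge1,\end{cases}$$ $$b_{r,\alpha}=\begin{cases}8\alpha\left(\frac{\mu}{r+2}\right)^{\frac{r+1}{r+2}}\left[\frac{\alpha^r}{48\,\Gamma(r)}\right]^{\frac{1}{r+2}},&0<r<1,\\[4pt] 4\alpha\left(\frac{\mu}{r+2}\right)^{2/3}\left[\frac{\alpha}{6\,\Gamma(r)}\left(\frac{r-1}{e}\right)^{r-1}\right]^{1/3},&r\ge1.\end{cases}$$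
   Context: $V\sim\mathrm{NB}(\kappa,p)$ means $\mathbb{P}(V=i)=\frac{\Gamma(\kappa+i)}{\Gamma(\kappa)\,i!}p^\kappa(1-p)^i$, $i=0,1,2,\dots$. $\mathscr{L}(X)$ is the law of $X$; $a\wedge b=\min(a,b)$; $0^0=1$. $\Gamma(r,\alpha)$ is the distribution with density $\frac{1}{\Gamma(r)}\alpha^r x^{r-1}e^{-\alpha x}$, $x>0$. $d_{\mathrm W}(\mathscr{L}(X),\mathscr{L}(Y))=\sup_{f}|\mathbb{E}f(X)-\mathbb{E}f(Y)|$ over all $f:\mathbb{R}\to\mathbb{R}$ with $|f(x)-f(y)|\le|x-y|$ for all $x,y\in\mathbb{R}$. $d_{\mathrm K}(\mathscr{L}(X),\mathscr{L}(Y))=\sup_{z\in\mathbb{R}}|\mathbb{P}(X\le z)-\mathbb{P}(Y\le z)|$. *)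

theory Defs
  imports "HOL-Probability.Probability"
begin

definition neg_binomial_rv :: "'a measure \<Rightarrow> ('a \<Rightarrow> nat) \<Rightarrow> real \<Rightarrow> real \<Rightarrow> bool" where
  "neg_binomial_rv M V \<kappa> p \<longleftrightarrow>
     V \<in> measurable M (count_space UNIV) \<and>
     (\<forall>i. measure M {\<omega> \<in> space M. V \<omega> = i} =
            Gamma (\<kappa> + real i) / (Gamma \<kappa> * fact i) * p powr \<kappa> * (1 - p) ^ i)"

definition gamma_density :: "real \<Rightarrow> real \<Rightarrow> real \<Rightarrow> real" where
  "gamma_density r \<alpha> x =
     (if x > 0 then 1 / Gamma r * \<alpha> powr r * x powr (r - 1) * exp (- \<alpha> * x) else 0)"

definition gamma_distribution :: "real \<Rightarrow> real \<Rightarrow> real measure" where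
  "gamma_distribution r \<alpha> = density lborel (\<lambda>x. ennreal (gamma_density r \<alpha> x))"

text \<open>
  The distances take values in \<^typ>\<open>ereal\<close>, so that the suprema exist unconditionally.
  The Wasserstein distance is meant for laws with finite first moment: then every Lipschitz
  function is integrable and the Bochner integrals below are genuine expectations.
\<close>

definition wasserstein_dist :: "real measure \<Rightarrow> real measure \<Rightarrow> ereal" where
  "wasserstein_dist P Q =
     (SUP f \<in> {f :: real \<Rightarrow> real. 1-lipschitz_on UNIV f}.
        ereal \<bar>integral\<^sup>L P f - integral\<^sup>L Q f\<bar>)"

definition kolmogorov_dist :: "real measure \<Rightarrow> real measure \<Rightarrow> ereal" where
  "kolmogorov_dist P Q = (SUP z. ereal \<bar>cdf P z - cdf Q z\<bar>)"

text \<open>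
  Real powers with the convention $0^0 = 1$; the library has \<^prop>\<open>(0::real) powr 0 = 0\<close>.
  This matters for $((r-1)/e)^{r-1}$ at $r = 1$.
\<close>

definition rpow :: "real \<Rightarrow> real \<Rightarrow> real" where
  "rpow x y = (if x = 0 \<and> y = 0 then 1 else x powr y)"

definition a_coef :: "real \<Rightarrow> real \<Rightarrow> real \<Rightarrow> real" where
  "a_coef \<mu> r \<alpha> =
     (if r < 1
      then (1 / 2 + 1 / r) * (48 * \<mu> / (r + 2)) powr (r / (r + 2))
             * (\<alpha> powr r / Gamma r) powr (2 / (r + 2))
      else 3 * (6 * \<mu> / (r + 2)) powr (1 / 3)
             * (\<alpha> / Gamma r * rpow ((r - 1) / exp 1) (r - 1)) powr (2 / 3))"

definition b_coef :: "real \<Rightarrow> real \<Rightarrow> real \<Rightarrow> real" where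
  "b_coef \<mu> r \<alpha> =
     (if r < 1
      then 8 * \<alpha> * (\<mu> / (r + 2)) powr ((r + 1) / (r + 2))
             * (\<alpha> powr r / (48 * Gamma r)) powr (1 / (r + 2))
      else 4 * \<alpha> * (\<mu> / (r + 2)) powr (2 / 3)
             * (\<alpha> / (6 * Gamma r) * rpow ((r - 1) / exp 1) (r - 1)) powr (1 / 3))"

end

theory Submission
  imports Defs "HOL-Real_Asymp.Real_Asymp"
begin

text \<open>
  Write $r = \kappa(1-p)$ and let $G \sim \Gamma(r,1)$. For a $1$-Lipschitz, differentiable $h$ the
  Stein equation $x g'(x) + (r-x) g(x) = h(x) - E h(G)$ has a solution with $|g| \le 1$ and
  $|x g''(x)| \le 4$. The recursion $(n+1)q_{n+1} = (1-p)(\kappa+n)q_n$ of the negative binomial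
  weights turns $E h(W) - E h(G)$ into $E[W(g'(W) - (g(W)-g(W-p))/p)]$, whose summands are at most
  $4p$ on $W > 0$ and vanish at $W = 0$. Hence $d_W \le 4 p\,P(T \ge 1)$, and
  $P(T \ge 1) \le \min(1, r/p)$ gives the Wasserstein bound.

  For the Kolmogorov distance, indicators are replaced by ramps of width $e$. A ramp is
  $1/e$-Lipschitz and costs the average over $[0,e]$ of the modulus of continuity of the gamma
  distribution function. When $r \ge 1$ both sides are compared by the inequality of arithmetic and
  geometric means; when $r < 1$ one takes for $e$ the width that is implicit in the coefficients.
\<close>

section \<open>The gamma density and its antiderivatives\<close>

text \<open>The factor P(T \<ge> 1) has to be kept: for fixed p and \<kappa> tending to 0 the
  Wasserstein bound tends to 0, while 4 p does not; for r < 1 the Kolmogorov estimate likewise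
  leaves for the ramp error only a quantity with a factor r. The factor comes from the atom at 0,
  where the Stein equation stays exact once g is extended by its limit g(0) = (h(0) - E h(G)) / r.
  The origin is also the analytic obstacle: only x g''(x) is controlled there, so g'' might grow
  like 1/x. The difference quotient produced by the weight recursion looks backwards from W and
  carries the factor W, which compensates for this even on the step from 0 to p. Moreover, h' is
  assumed to be bounded, not continuous. Hence nothing containing it is integrated: the bounds on
  g'' and on the difference quotient come from the sign of a derivative together with the behaviour
  at the ends of an interval.\<close>

lemma gamma_density_eq:
  "x > 0 \<Longrightarrow> gamma_density r 1 x = x powr (r - 1) * exp (- x) / Gamma r"
  by (simp add: gamma_density_def)

lemma gamma_density_nonpos: "x \<le> 0 \<Longrightarrow> gamma_density r 1 x = 0"
  by (simp add: gamma_density_def)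

lemma gamma_density_pos: "r > 0 \<Longrightarrow> x > 0 \<Longrightarrow> gamma_density r 1 x > 0"
  by (simp add: gamma_density_def Gamma_real_pos)

lemma gamma_density_nonneg: "r > 0 \<Longrightarrow> gamma_density r 1 x \<ge> 0"
  by (simp add: gamma_density_def Gamma_real_pos less_imp_le)

lemma measurable_gamma_density [measurable]: "gamma_density r \<alpha> \<in> borel_measurable borel"
  unfolding gamma_density_def by measurable

text \<open>Size biasing raises the shape by one; the first moment then needs no integral of its
  own.\<close>

lemma gamma_density_plus1:
  assumes "r > 0"
  shows "r * gamma_density (r + 1) 1 x = x * gamma_density r 1 x"
proof (cases "x > 0")
  case True
  have "Gamma (r + 1) = r * Gamma r"
    using assms by (intro Gamma_plus1) (auto elim!: nonpos_Ints_cases)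
  moreover have "x powr r = x * x powr (r - 1)"
    using True by (simp add: powr_diff)
  ultimately show ?thesis using True assms Gamma_real_pos[OF assms]
    by (simp add: gamma_density_eq)
qed (simp add: gamma_density_nonpos)

lemma nn_integral_gamma_density:
  assumes "r > 0"
  shows "(\<integral>\<^sup>+x. ennreal (gamma_density r 1 x) \<partial>lborel) = 1"
proof -
  have "((\<lambda>t. t powr (r - 1) / exp t / Gamma r) has_integral Gamma r / Gamma r) {0..}"
    by (intro has_integral_divide Gamma_integral_real assms)
  hence "((\<lambda>t. t powr (r - 1) / exp t / Gamma r) has_integral 1) {0..}"
    using Gamma_real_pos[OF assms] by simp
  hence "((\<lambda>t. gamma_density r 1 t) has_integral 1) {0..}"
    by (rule has_integral_spike[of "{0}", rotated 2])
       (auto simp: gamma_density_eq exp_minus field_simps)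
  hence "((\<lambda>t. gamma_density r 1 t) has_integral 1) UNIV"
    by (rule has_integral_on_superset) (auto simp: gamma_density_nonpos)
  from nn_integral_has_integral_lborel[OF _ _ this] show ?thesis
    using gamma_density_nonneg[OF assms] by simp
qed

lemma integrable_gamma_density: "r > 0 \<Longrightarrow> integrable lborel (gamma_density r 1)"
  by (rule integrableI_nonneg) (auto simp: gamma_density_nonneg nn_integral_gamma_density)

lemma prob_space_gamma_distribution:
  assumes "r > 0"
  shows "prob_space (gamma_distribution r 1)"
  by standard (simp add: gamma_distribution_def emeasure_density nn_integral_gamma_density assms)

lemma sets_gamma_distribution [simp, measurable_cong]:
  "sets (gamma_distribution r \<alpha>) = sets borel"
  by (simp add: gamma_distribution_def)

lemma space_gamma_distribution [simp]: "space (gamma_distribution r \<alpha>) = UNIV"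
  by (simp add: gamma_distribution_def)

lemma integrable_gamma_distribution_iff:
  fixes f :: "real \<Rightarrow> real"
  assumes "r > 0" and [measurable]: "f \<in> borel_measurable borel"
  shows "integrable (gamma_distribution r 1) f \<longleftrightarrow>
           integrable lborel (\<lambda>x. f x * gamma_density r 1 x)"
  unfolding gamma_distribution_def using gamma_density_nonneg[OF assms(1)]
  by (subst integrable_density) (auto simp: mult.commute)

lemma integral_gamma_distribution:
  fixes f :: "real \<Rightarrow> real"
  assumes "r > 0" and [measurable]: "f \<in> borel_measurable borel"
  shows "integral\<^sup>L (gamma_distribution r 1) f = (\<integral>x. f x * gamma_density r 1 x \<partial>lborel)"
  unfolding gamma_distribution_def using gamma_density_nonneg[OF assms(1)]
  by (subst integral_density) (auto simp: mult.commute)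

lemma integrable_gamma_distribution_id:
  assumes "r > 0"
  shows "integrable (gamma_distribution r 1) (\<lambda>x. x)"
proof -
  have "integrable lborel (\<lambda>x. r * gamma_density (r + 1) 1 x)"
    using assms by (intro integrable_mult_right integrable_gamma_density) auto
  thus ?thesis using assms
    by (subst integrable_gamma_distribution_iff) (simp_all add: gamma_density_plus1)
qed

lemma gamma_density_mult_deriv:
  assumes r: "r > 0" and "x > 0"
  shows "((\<lambda>x. x * gamma_density r 1 x) has_real_derivative (r - x) * gamma_density r 1 x) (at x)"
proof -
  have "((\<lambda>x. x powr r * exp (- x)) has_real_derivative
          (r * x powr (r - 1) * exp (- x) - x powr r * exp (- x))) (at x)"
    using assms by (auto intro!: derivative_eq_intros simp: powr_diff field_simps)
  from DERIV_cdivide[OF this, of "Gamma r"]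
  have "((\<lambda>x. x powr r * exp (- x) / Gamma r) has_real_derivative
          (r * x powr (r - 1) * exp (- x) - x powr r * exp (- x)) / Gamma r) (at x)" .
  moreover have "r * x powr (r - 1) * exp (- x) - x powr r * exp (- x) =
      (r - x) * (x powr (r - 1) * exp (- x))"
    using assms by (simp add: powr_diff field_simps)
  ultimately have "((\<lambda>x. x powr r * exp (- x) / Gamma r) has_real_derivative
          (r - x) * gamma_density r 1 x) (at x)"
    using assms by (simp add: gamma_density_eq)
  thus ?thesis
    by (rule has_field_derivative_transform_within_open[where S = "{0<..}"])
       (use assms in \<open>auto simp: gamma_density_eq powr_diff\<close>)
qed

lemma continuous_on_gamma_density: "continuous_on {0<..} (gamma_density r 1)"
proof -
  have "continuous_on {0<..} (\<lambda>x. x powr (r - 1) * exp (- x) * (1 / Gamma r))"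
    by (intro continuous_intros) auto
  thus ?thesis
    by (rule continuous_on_eq) (simp add: gamma_density_eq)
qed

text \<open>Integrating from the left makes \<open>S\<close> vanish at 0, and the zero mean of
  \<open>k\<close> makes it vanish at infinity. The later sign arguments rest on these two boundary
  values.\<close>

lemma density_antiderivative:
  fixes k :: "real \<Rightarrow> real"
  assumes r: "r > 0" and cont: "continuous_on UNIV k"
    and int: "integrable (gamma_distribution r 1) k"
    and zero: "integral\<^sup>L (gamma_distribution r 1) k = 0"
  obtains S where
    "\<And>x. x > 0 \<Longrightarrow> (S has_real_derivative k x * gamma_density r 1 x) (at x)"
    "(S \<longlongrightarrow> 0) (at_right 0)" "(S \<longlongrightarrow> 0) at_top"
proof -
  have [measurable]: "k \<in> borel_measurable borel"
    using cont by (rule borel_measurable_continuous_onI)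
  define f where "f = (\<lambda>x. k x * gamma_density r 1 x)"
  have [measurable]: "f \<in> borel_measurable borel" unfolding f_def by measurable
  have f_int: "integrable lborel f"
    using int r by (simp add: f_def integrable_gamma_distribution_iff)
  have f0: "f x = 0" if "x \<le> 0" for x using that by (simp add: f_def gamma_density_nonpos)
  define S where "S y = (\<integral>x. indicator {..y} x *\<^sub>R f x \<partial>lborel)" for y
  have "(S \<longlongrightarrow> integral\<^sup>L lborel f) at_top"
    unfolding S_def by (intro tendsto_integral_at_top f_int) auto
  also have "integral\<^sup>L lborel f = 0"
    using zero r by (simp add: f_def integral_gamma_distribution)
  finally have top: "(S \<longlongrightarrow> 0) at_top" .
  have "(S \<longlongrightarrow> integral\<^sup>L lborel (\<lambda>x::real. 0)) (at_right (0::real))"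
  proof (rule tendsto_at_right_sequentially[of 0 1])
    fix X :: "nat \<Rightarrow> real"
    assume X: "\<And>n. 0 < X n" "\<And>n. X n < 1" "X \<longlonglongrightarrow> 0"
    show "(\<lambda>n. S (X n)) \<longlonglongrightarrow> integral\<^sup>L lborel (\<lambda>x::real. 0)" unfolding S_def
    proof (rule integral_dominated_convergence[where w = "\<lambda>x. norm (f x)"])
      show "AE x in lborel. (\<lambda>n. indicator {..X n} x *\<^sub>R f x) \<longlonglongrightarrow> 0"
      proof (intro AE_I2)
        fix x :: real
        show "(\<lambda>n. indicator {..X n} x *\<^sub>R f x) \<longlonglongrightarrow> 0"
        proof (cases "x \<le> 0")
          case False
          hence "eventually (\<lambda>n. X n < x) sequentially" using X(3) by (intro order_tendstoD) auto
          hence "eventually (\<lambda>n. indicator {..X n} x *\<^sub>R f x = 0) sequentially"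
            by eventually_elim auto
          thus ?thesis by (rule tendsto_eventually)
        qed (simp add: f0)
      qed
    qed (use f_int in \<open>auto simp: indicator_def intro: integrable_norm\<close>)
  qed auto
  hence zero: "(S \<longlongrightarrow> 0) (at_right 0)" by simp
  have "(S has_real_derivative f x) (at x)" if x: "x > 0" for x
  proof -
    \<comment> \<open>For r < 1 the density is unbounded at 0, so the fundamental theorem is applied
      on an interval away from 0; the mass to the left of \<open>a\<close> is a constant.\<close>
    define a where "a = x / 2"
    have a: "0 < a" "a < x" using x by (auto simp: a_def)
    have cf: "continuous_on {a..x + 1} f" unfolding f_def
      by (intro continuous_intros continuous_on_subset[OF cont]
            continuous_on_subset[OF continuous_on_gamma_density]) (use a in auto)
    have eq: "S y = S a + integral {a..y} f" if "y \<in> {a..x+1}" for y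
    proof -
      have i: "integrable lborel (\<lambda>t. indicator {a..y} t *\<^sub>R f t)"
        by (intro integrable_scaleR_left f_int integrable_mult_indicator) auto
      have i2: "integrable lborel (\<lambda>t. indicator {..a} t *\<^sub>R f t)"
        by (intro integrable_scaleR_left f_int integrable_mult_indicator) auto
      have "integral {a..y} f = set_lebesgue_integral lborel {a..y} f"
        by (intro set_borel_integral_eq_integral(2)[symmetric])
           (use i in \<open>simp add: set_integrable_def\<close>)
      also have "\<dots> = (\<integral>t. indicator {a..y} t *\<^sub>R f t \<partial>lborel)"
        by (simp add: set_lebesgue_integral_def)
      finally have "S a + integral {a..y} f =
          (\<integral>t. indicator {..a} t *\<^sub>R f t + indicator {a..y} t *\<^sub>R f t \<partial>lborel)"
        using i i2 by (simp add: S_def)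
      also have "\<dots> = S y" unfolding S_def
      proof (rule integral_cong_AE)
        show "AE t in lborel. indicator {..a} t *\<^sub>R f t + indicator {a..y} t *\<^sub>R f t =
            indicator {..y} t *\<^sub>R f t"
          using AE_lborel_singleton[of a] by eventually_elim (use that in \<open>auto simp: indicator_def\<close>)
      qed auto
      finally show ?thesis by simp
    qed
    have "((\<lambda>y. integral {a..y} f) has_real_derivative f x) (at x within {a..x+1})"
      by (rule integral_has_real_derivative[OF cf]) (use a in auto)
    hence "((\<lambda>y. integral {a..y} f) has_real_derivative f x) (at x)"
      using a by (simp add: at_within_interior[of x "{a..x+1}"])
    hence *: "((\<lambda>y. S a + integral {a..y} f) has_real_derivative f x) (at x)"
      by (auto intro!: derivative_eq_intros)
    show ?thesis
      by (rule has_field_derivative_transform_within_open[OF *, where S = "{a<..<x+1}"])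
         (use a in \<open>auto intro!: eq[symmetric]\<close>)
  qed
  thus ?thesis using that[of S] top zero by (simp add: f_def)
qed

section \<open>The gamma Stein equation\<close>

lemma has_derivative_nonneg_imp_le:
  fixes A :: "real \<Rightarrow> real"
  assumes "\<And>x. x \<in> {a..b} \<Longrightarrow> (A has_real_derivative A' x) (at x)"
    and "\<And>x. x \<in> {a..b} \<Longrightarrow> A' x \<ge> 0" and "a \<le> b"
  shows "A a \<le> A b"
  using assms by (intro DERIV_nonneg_imp_nondecreasing[of a b A]) (auto intro: exI[of _ "A' _"])

lemma incr_from_zero_limit:
  fixes A :: "real \<Rightarrow> real"
  assumes deriv: "\<And>y. 0 < y \<Longrightarrow> y \<le> x \<Longrightarrow> (A has_real_derivative A' y) (at y)"
    and nonneg: "\<And>y. 0 < y \<Longrightarrow> y \<le> x \<Longrightarrow> A' y \<ge> 0"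
    and lim: "(A \<longlongrightarrow> 0) (at_right 0)" and "x > 0"
  shows "A x \<ge> 0"
proof (rule tendsto_upperbound[OF lim])
  show "eventually (\<lambda>y. A y \<le> A x) (at_right 0)"
    using eventually_at_right_real[OF \<open>x > 0\<close>]
  proof eventually_elim
    case (elim y)
    show ?case
      by (rule has_derivative_nonneg_imp_le[where A' = A'])
         (use elim in \<open>auto intro: deriv nonneg\<close>)
  qed
qed auto

lemma decr_to_zero_limit:
  fixes A :: "real \<Rightarrow> real"
  assumes deriv: "\<And>y. y \<ge> x \<Longrightarrow> (A has_real_derivative A' y) (at y)"
    and nonpos: "\<And>y. y \<ge> x \<Longrightarrow> A' y \<le> 0"
    and lim: "(A \<longlongrightarrow> 0) at_top"
  shows "A x \<ge> 0"
proof (rule tendsto_upperbound[OF lim])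
  show "eventually (\<lambda>y. A y \<le> A x) at_top"
    using eventually_ge_at_top[of x]
  proof eventually_elim
    case (elim y)
    have "- A x \<le> - A y"
      by (rule has_derivative_nonneg_imp_le[where A' = "\<lambda>y. - A' y"])
         (use elim in \<open>auto intro: DERIV_minus deriv nonpos\<close>)
    thus ?case by simp
  qed
qed auto

text \<open>A decreasing \<open>k\<close> changes sign at most once, so \<open>A\<close> first increases from $0$ and then
  decreases to $0$.\<close>

lemma nonneg_of_decreasing_factor:
  fixes A :: "real \<Rightarrow> real"
  assumes deriv: "\<And>y. 0 < y \<Longrightarrow> (A has_real_derivative k y * w y) (at y)"
    and decr: "\<And>y z. 0 < y \<Longrightarrow> y \<le> z \<Longrightarrow> k z \<le> k y"
    and w: "\<And>y. y > 0 \<Longrightarrow> w y \<ge> 0"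
    and lim: "(A \<longlongrightarrow> 0) (at_right 0)" "(A \<longlongrightarrow> 0) at_top" and "x > 0"
  shows "A x \<ge> 0"
proof (cases "k x \<ge> 0")
  case True
  show ?thesis
  proof (rule incr_from_zero_limit[OF _ _ lim(1) \<open>x > 0\<close>])
    show "(A has_real_derivative k y * w y) (at y)" if "y > 0" for y using deriv that .
    show "k y * w y \<ge> 0" if "0 < y" "y \<le> x" for y
      using True decr[OF that] w[of y] that by simp
  qed
next
  case False
  show ?thesis
  proof (rule decr_to_zero_limit[OF _ _ lim(2)])
    show "(A has_real_derivative k y * w y) (at y)" if "x \<le> y" for y
      using deriv that \<open>x > 0\<close> by simp
    show "k y * w y \<le> 0" if "x \<le> y" for y
      using False decr[of x y] w[of y] that \<open>x > 0\<close> by (intro mult_nonpos_nonneg) auto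
  qed
qed

lemma gamma_density_mult_tendsto_0:
  assumes "r > 0"
  shows "((\<lambda>x. x * gamma_density r 1 x) \<longlongrightarrow> 0) (at_right 0)"
proof -
  have "((\<lambda>x. x powr r * exp (- x)) \<longlongrightarrow> 0) (at_right 0)"
    using assms by real_asymp
  hence "((\<lambda>x. x powr r * exp (- x) / Gamma r) \<longlongrightarrow> 0) (at_right 0)"
    using tendsto_mult_left_zero[of _ "at_right 0" "1 / Gamma r"] by simp
  moreover have "eventually (\<lambda>x. x powr r * exp (- x) / Gamma r = x * gamma_density r 1 x) (at_right 0)"
    using eventually_at_right_less[of 0]
    by eventually_elim (simp add: gamma_density_eq powr_diff)
  ultimately show ?thesis by (rule Lim_transform_eventually)
qed

lemma gamma_density_poly_tendsto_0_at_top: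
  assumes "r > 0"
  shows "((\<lambda>x. x powr b * gamma_density r 1 x) \<longlongrightarrow> 0) at_top"
proof -
  have "((\<lambda>x. x powr (b + r - 1) * exp (- x)) \<longlongrightarrow> 0) at_top"
    by real_asymp
  hence "((\<lambda>x. x powr (b + r - 1) * exp (- x) / Gamma r) \<longlongrightarrow> 0) at_top"
    using tendsto_mult_left_zero[of _ at_top "1 / Gamma r"] by simp
  moreover have "eventually (\<lambda>x. x powr (b + r - 1) * exp (- x) / Gamma r = x powr b * gamma_density r 1 x) at_top"
    using eventually_gt_at_top[of 0]
    by eventually_elim (simp add: gamma_density_eq powr_diff powr_add)
  ultimately show ?thesis by (rule Lim_transform_eventually)
qed

section \<open>The Stein solution and its first-order bound\<close>

locale gamma_stein =
  fixes r :: real and h h' :: "real \<Rightarrow> real"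
  assumes r: "r > 0"
    and h_deriv: "\<And>x. (h has_real_derivative h' x) (at x)"
    and h'_le: "\<And>x. \<bar>h' x\<bar> \<le> 1"
begin

definition "w = gamma_density r 1"
text \<open>The integrating factor of the Stein operator: the derivative of \<open>v x * g x\<close>
  is \<open>w x\<close> times \<open>x * g' x + (r - x) * g x\<close>. Up to the factor
  \<open>r\<close> it is the density of the gamma law with shape r + 1.\<close>

definition "v x = x * w x"
definition "ht x = h x - integral\<^sup>L (gamma_distribution r 1) h"

lemma h_cont: "continuous_on UNIV h"
  using h_deriv by (intro continuous_at_imp_continuous_on) (auto intro: DERIV_isCont)

lemma h_lipschitz: "\<bar>h x - h y\<bar> \<le> \<bar>x - y\<bar>"
  using field_differentiable_bound[of UNIV h h' 1 x y] h_deriv h'_le by simp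

lemma ht_deriv: "(ht has_real_derivative h' x) (at x)"
  unfolding ht_def by (auto intro!: derivative_eq_intros h_deriv)

lemma ht_bound: "\<bar>ht x\<bar> \<le> \<bar>x\<bar> + \<bar>ht 0\<bar>"
  using h_lipschitz[of x 0] by (simp add: ht_def)

lemma h_measurable [measurable]: "h \<in> borel_measurable borel"
  using h_cont by (rule borel_measurable_continuous_onI)

lemma h_integrable: "integrable (gamma_distribution r 1) h"
proof -
  interpret prob_space "gamma_distribution r 1" by (rule prob_space_gamma_distribution[OF r])
  have "integrable (gamma_distribution r 1) (\<lambda>x. \<bar>x\<bar> + \<bar>h 0\<bar>)"
    using integrable_gamma_distribution_id[OF r] by auto
  thus ?thesis
  proof (rule Bochner_Integration.integrable_bound)
    have "norm (h x) \<le> norm (\<bar>x\<bar> + \<bar>h 0\<bar>)" for x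
      using h_lipschitz[of x 0] by simp
    thus "AE x in gamma_distribution r 1. norm (h x) \<le> norm (\<bar>x\<bar> + \<bar>h 0\<bar>)" by simp
  qed auto
qed

lemma v_deriv: "x > 0 \<Longrightarrow> (v has_real_derivative (r - x) * w x) (at x)"
  unfolding v_def w_def using gamma_density_mult_deriv[OF r] by simp

lemma v_pos: "x > 0 \<Longrightarrow> v x > 0"
  by (simp add: v_def w_def gamma_density_pos r)

lemma v_lim_0: "(v \<longlongrightarrow> 0) (at_right 0)"
  unfolding v_def w_def by (rule gamma_density_mult_tendsto_0[OF r])

lemma v_lim_top: "(v \<longlongrightarrow> 0) at_top" "((\<lambda>x. x * v x) \<longlongrightarrow> 0) at_top"
proof -
  have "eventually (\<lambda>x. x powr 1 * w x = v x) at_top" "eventually (\<lambda>x. x powr 2 * w x = x * v x) at_top"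
    using eventually_gt_at_top[of 0] by (eventually_elim, simp add: v_def power2_eq_square)+
  thus "(v \<longlongrightarrow> 0) at_top" "((\<lambda>x. x * v x) \<longlongrightarrow> 0) at_top"
    using gamma_density_poly_tendsto_0_at_top[OF r, of 1] gamma_density_poly_tendsto_0_at_top[OF r, of 2]
    by (auto simp: w_def intro: Lim_transform_eventually)
qed

text \<open>The integrating factor yields \<open>g\<close> as \<open>S / v\<close>, where
  \<open>S\<close> is the antiderivative of \<open>ht\<close> against the density. The value
  \<open>g 0\<close> is the limit at 0, so that the equation persists there.\<close>

lemma stein_solution:
  obtains g g' where
    "(g \<longlongrightarrow> g 0) (at_right 0)" "r * g 0 = ht 0"
    "\<And>x. x > 0 \<Longrightarrow> (g has_real_derivative g' x) (at x)"
    "\<And>x. x > 0 \<Longrightarrow> x * g' x + (r - x) * g x = ht x"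
    "\<And>x. x > 0 \<Longrightarrow> \<bar>g x\<bar> \<le> 1"
proof -
  interpret G: prob_space "gamma_distribution r 1" by (rule prob_space_gamma_distribution[OF r])
  have ht: "continuous_on UNIV ht" "integrable (gamma_distribution r 1) ht"
      "integral\<^sup>L (gamma_distribution r 1) ht = 0"
    unfolding ht_def using h_integrable G.prob_space by (auto intro!: continuous_intros h_cont)
  obtain S where S: "\<And>x. x > 0 \<Longrightarrow> (S has_real_derivative ht x * w x) (at x)"
    "(S \<longlongrightarrow> 0) (at_right 0)" "(S \<longlongrightarrow> 0) at_top"
    unfolding w_def by (rule density_antiderivative[OF r ht]) blast
  define g where "g x = (if x > 0 then S x / v x else ht 0 / r)" for x
  define g' where "g' x = (ht x * w x * v x - S x * ((r - x) * w x)) / (v x * v x)" for x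
  \<comment> \<open>Both \<open>S\<close> and \<open>v\<close> vanish at 0, so L'Hopital's rule
    reduces \<open>g 0\<close> to this quotient of their derivatives.\<close>
  have "((\<lambda>x. (ht x * w x) / ((r - x) * w x)) \<longlongrightarrow> ht 0 / r) (at_right 0)"
  proof (rule Lim_transform_eventually)
    have "(ht \<longlongrightarrow> ht 0) (at_right 0)"
      using DERIV_isCont[OF ht_deriv[of 0]] by (simp add: isCont_def filterlim_at_split)
    thus "((\<lambda>x. ht x / (r - x)) \<longlongrightarrow> ht 0 / r) (at_right 0)"
      using r by (auto intro!: tendsto_eq_intros)
    show "eventually (\<lambda>x. ht x / (r - x) = ht x * w x / ((r - x) * w x)) (at_right 0)"
      using eventually_at_right_less[of 0]
    proof eventually_elim
      case (elim x)
      thus ?case using gamma_density_pos[OF r, of x] by (simp add: w_def)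
    qed
  qed
  hence "((\<lambda>x. S x / v x) \<longlongrightarrow> ht 0 / r) (at_right 0)"
  proof (rule lhopital_right_0[OF S(2) v_lim_0, rotated -1])
    have pos: "eventually (\<lambda>x. x > 0 \<and> x < r) (at_right 0)"
      using eventually_at_right_real[OF r] by eventually_elim auto
    show "eventually (\<lambda>x. v x \<noteq> 0) (at_right 0)"
      using pos by eventually_elim (use v_pos in fastforce)
    show "eventually (\<lambda>x. (r - x) * w x \<noteq> 0) (at_right 0)"
      using pos by eventually_elim (use gamma_density_pos[OF r] in \<open>fastforce simp: w_def\<close>)
    show "eventually (\<lambda>x. (S has_real_derivative ht x * w x) (at x)) (at_right 0)"
      using pos by eventually_elim (use S(1) in auto)
    show "eventually (\<lambda>x. (v has_real_derivative (r - x) * w x) (at x)) (at_right 0)"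
      using pos by eventually_elim (use v_deriv in auto)
  qed
  moreover have "eventually (\<lambda>x. S x / v x = g x) (at_right 0)"
    using eventually_at_right_less[of 0] by eventually_elim (simp add: g_def)
  ultimately have lim: "(g \<longlongrightarrow> g 0) (at_right 0)"
    by (simp add: g_def Lim_transform_eventually)
  have deriv: "(g has_real_derivative g' x) (at x)" if "x > 0" for x
  proof -
    have *: "((\<lambda>x. S x / v x) has_real_derivative g' x) (at x)"
      unfolding g'_def using that v_pos[OF that] by (intro DERIV_divide S v_deriv) auto
    show ?thesis
      by (rule has_field_derivative_transform_within_open[OF *, where S = "{0<..}"])
         (use that in \<open>auto simp: g_def\<close>)
  qed
  have eq: "x * g' x + (r - x) * g x = ht x" if "x > 0" for x
  proof -
    have "w x > 0" using gamma_density_pos[OF r that] by (simp add: w_def)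
    thus ?thesis using that by (simp add: g_def g'_def v_def divide_simps algebra_simps)
  qed
  have le: "\<bar>g x\<bar> \<le> 1" if x: "x > 0" for x
  proof -
    have mono: "\<bar>ht z - ht y\<bar> \<le> z - y" if "y \<le> z" for y z
      using h_lipschitz[of z y] that by (simp add: ht_def)
    have w: "w y \<ge> 0" for y using gamma_density_nonneg[OF r] by (simp add: w_def)
    \<comment> \<open>The bound on g says that v + S and v - S are nonnegative. In their derivatives
      the density is multiplied by r - y plus or minus \<open>ht y\<close>, which decreases because
      \<open>ht\<close> is 1-Lipschitz and cannot outrun the slope -1.\<close>
    have "v x + S x \<ge> 0"
    proof (rule nonneg_of_decreasing_factor[where A = "\<lambda>y. v y + S y" and k = "\<lambda>y. (r - y) + ht y" and w = w])
      show "((\<lambda>y. v y + S y) has_real_derivative ((r - y) + ht y) * w y) (at y)" if "y > 0" for y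
        using that by (auto intro!: derivative_eq_intros S v_deriv simp: algebra_simps)
      show "(r - z) + ht z \<le> (r - y) + ht y" if "y \<le> z" for y z using mono[OF that] by simp
      show "((\<lambda>y. v y + S y) \<longlongrightarrow> 0) (at_right 0)" "((\<lambda>y. v y + S y) \<longlongrightarrow> 0) at_top"
        using tendsto_add[OF v_lim_0 S(2)] tendsto_add[OF v_lim_top(1) S(3)] by simp_all
    qed (use x w in auto)
    moreover have "v x - S x \<ge> 0"
    proof (rule nonneg_of_decreasing_factor[where A = "\<lambda>y. v y - S y" and k = "\<lambda>y. (r - y) - ht y" and w = w])
      show "((\<lambda>y. v y - S y) has_real_derivative ((r - y) - ht y) * w y) (at y)" if "y > 0" for y
        using that by (auto intro!: derivative_eq_intros S v_deriv simp: algebra_simps)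
      show "(r - z) - ht z \<le> (r - y) - ht y" if "y \<le> z" for y z using mono[OF that] by simp
      show "((\<lambda>y. v y - S y) \<longlongrightarrow> 0) (at_right 0)" "((\<lambda>y. v y - S y) \<longlongrightarrow> 0) at_top"
        using tendsto_diff[OF v_lim_0 S(2)] tendsto_diff[OF v_lim_top(1) S(3)] by simp_all
    qed (use x w in auto)
    ultimately show ?thesis using v_pos[OF x] x by (simp add: g_def abs_le_iff field_simps)
  qed
  have g0: "r * g 0 = ht 0" using r by (simp add: g_def)
  show thesis by (rule that[of g g']; fact lim g0 deriv eq le)
qed

end

section \<open>Second-order bounds on the Stein solution\<close>

context gamma_stein
begin

text \<open>Differentiating the Stein equation yields x g'' + (r + 1 - x) g' = h' + g, the Stein
  equation of shape r + 1 for g', with a right-hand side of absolute value at most 2. It remains to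
  bound (r + 1 - x) g' by 2 as well; the constant 4 is 2 + 2.\<close>

lemma stein_solution_second_order:
  obtains g g' g'' where
    "(g \<longlongrightarrow> g 0) (at_right 0)" "((\<lambda>x. x * g' x) \<longlongrightarrow> 0) (at_right 0)" "r * g 0 = ht 0"
    "\<And>x. x > 0 \<Longrightarrow> (g has_real_derivative g' x) (at x)"
    "\<And>x. x > 0 \<Longrightarrow> (g' has_real_derivative g'' x) (at x)"
    "\<And>x. x > 0 \<Longrightarrow> x * g' x + (r - x) * g x = ht x"
    "\<And>x. x > 0 \<Longrightarrow> \<bar>g x\<bar> \<le> 1"
    "\<And>x. x > 0 \<Longrightarrow> \<bar>x * g'' x\<bar> \<le> 4"
proof -
  obtain g g' where g: "(g \<longlongrightarrow> g 0) (at_right 0)" "r * g 0 = ht 0"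
    "\<And>x. x > 0 \<Longrightarrow> (g has_real_derivative g' x) (at x)"
    "\<And>x. x > 0 \<Longrightarrow> x * g' x + (r - x) * g x = ht x"
    "\<And>x. x > 0 \<Longrightarrow> \<bar>g x\<bar> \<le> 1"
    by (rule stein_solution) blast
  define c where "c = r + 1"
  \<comment> \<open>For x > 0 this is x g'(x), written without g' so that its derivative and its
    limit at 0 can be read off.\<close>
  define u where "u x = ht x - (r - x) * g x" for x
  have u_eq: "u x = x * g' x" if "x > 0" for x using g(4)[OF that] by (simp add: u_def)
  have u_deriv: "(u has_real_derivative h' x + g x - (r - x) * g' x) (at x)" if "x > 0" for x
    unfolding u_def using that by (auto intro!: derivative_eq_intros ht_deriv g(3))
  define g'' where "g'' x = (h' x + g x - (c - x) * g' x) / x" for x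
  have g'_deriv: "(g' has_real_derivative g'' x) (at x)" if x: "x > 0" for x
  proof -
    have "((\<lambda>x. u x / x) has_real_derivative
        ((h' x + g x - (r - x) * g' x) * x - u x * 1) / (x * x)) (at x)"
      using x by (intro DERIV_divide u_deriv DERIV_ident) auto
    also have "((h' x + g x - (r - x) * g' x) * x - u x * 1) / (x * x) = g'' x"
      using x by (simp add: u_eq g''_def c_def divide_simps algebra_simps)
    finally show ?thesis
      by (rule has_field_derivative_transform_within_open[where S = "{0<..}"])
         (use x in \<open>auto simp: u_eq\<close>)
  qed
  have u_lim: "(u \<longlongrightarrow> 0) (at_right 0)"
  proof -
    have "(ht \<longlongrightarrow> ht 0) (at_right 0)"
      using DERIV_isCont[OF ht_deriv[of 0]] by (simp add: isCont_def filterlim_at_split)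
    hence "(u \<longlongrightarrow> ht 0 - (r - 0) * g 0) (at_right 0)"
      unfolding u_def by (intro tendsto_intros g(1))
    thus ?thesis by (simp add: g(2))
  qed
  have u_le: "\<bar>u x\<bar> \<le> 2 * x + (r + \<bar>ht 0\<bar>)" if x: "x > 0" for x
  proof -
    have "\<bar>(r - x) * g x\<bar> \<le> (r + x) * 1"
      unfolding abs_mult using g(5)[OF x] x r by (intro mult_mono) auto
    thus ?thesis using ht_bound[of x] x by (simp add: u_def)
  qed
  \<comment> \<open>Since \<open>v\<close> is proportional to the density of shape r + 1, x v is the
    integrating factor of the differentiated equation: \<open>U\<close> equals x v g', and its
    derivative is \<open>q\<close> times \<open>v\<close>.\<close>
  define U where "U x = u x * v x" for x
  define q where "q x = h' x + g x" for x
  have q_le: "\<bar>q x\<bar> \<le> 2" if "x > 0" for x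
    using h'_le[of x] g(5)[OF that] by (simp add: q_def)
  have U_deriv: "(U has_real_derivative q x * v x) (at x)" if x: "x > 0" for x
  proof -
    have "(U has_real_derivative (h' x + g x - (r - x) * g' x) * v x + ((r - x) * w x) * u x) (at x)"
      unfolding U_def using x by (intro DERIV_mult u_deriv v_deriv)
    also have "(h' x + g x - (r - x) * g' x) * v x + ((r - x) * w x) * u x = q x * v x"
      using x by (simp add: u_eq v_def q_def algebra_simps)
    finally show ?thesis .
  qed
  have U_lim_0: "(U \<longlongrightarrow> 0) (at_right 0)"
    unfolding U_def using tendsto_mult[OF u_lim v_lim_0] by simp
  have U_lim_top: "(U \<longlongrightarrow> 0) at_top"
  proof (rule Lim_null_comparison)
    show "eventually (\<lambda>x. norm (U x) \<le> 2 * (x * v x) + (r + \<bar>ht 0\<bar>) * v x) at_top"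
      using eventually_gt_at_top[of 0]
    proof eventually_elim
      case (elim x)
      have "norm (U x) = \<bar>u x\<bar> * v x" using v_pos[OF elim] by (simp add: U_def abs_mult)
      also have "\<dots> \<le> (2 * x + (r + \<bar>ht 0\<bar>)) * v x"
        using u_le[OF elim] v_pos[OF elim] by (intro mult_right_mono) auto
      finally show ?case by (simp add: algebra_simps)
    qed
    show "((\<lambda>x. 2 * (x * v x) + (r + \<bar>ht 0\<bar>) * v x) \<longlongrightarrow> 0) at_top"
      by (rule tendsto_eq_intros tendsto_intros v_lim_top refl)+ simp
  qed
  have xv_deriv: "((\<lambda>x. x * v x) has_real_derivative (c - x) * v x) (at x)" if "x > 0" for x
    using DERIV_mult[OF DERIV_ident v_deriv[OF that]] by (simp add: v_def c_def algebra_simps)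
  have alg: "(2 * ((- d) * V) * d - 2 * N * 1) / (d * d) = - 2 * V - 2 * N / (d * d)"
    if "d \<noteq> 0" for d V N :: real
    using that by (simp add: diff_divide_distrib)
  \<comment> \<open>As \<open>U' = q v\<close> with \<open>\<bar>q\<bar> \<le> 2\<close>, both differences \<open>2 x v / \<bar>x - c\<bar> \<plusminus> U\<close> are monotone on
    each side of the mean \<open>c = r + 1\<close> of the next gamma law and vanish at its outer end.\<close>
  have key: "s * U x \<le> 2 * (x * v x) / \<bar>x - c\<bar>" if x: "x > 0" "x \<noteq> c" and s: "s \<in> {1, -1}" for x s
  proof (cases "x > c")
    case True
    have "2 * (x * v x) / (x - c) - s * U x \<ge> 0"
    proof (rule decr_to_zero_limit[where A = "\<lambda>x. 2 * (x * v x) / (x - c) - s * U x"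
          and A' = "\<lambda>y. (2 * ((c - y) * v y) * (y - c) - 2 * (y * v y) * 1) / ((y - c) * (y - c))
            - s * (q y * v y)"])
      fix y assume "x \<le> y"
      hence y: "y > 0" "y > c" using True x by auto
      show "((\<lambda>x. 2 * (x * v x) / (x - c) - s * U x) has_real_derivative
         (2 * ((c - y) * v y) * (y - c) - 2 * (y * v y) * 1) / ((y - c) * (y - c))
            - s * (q y * v y)) (at y)"
        using y by (intro DERIV_diff DERIV_divide DERIV_cmult xv_deriv U_deriv)
          (auto intro!: derivative_eq_intros)
      have "(2 * ((c - y) * v y) * (y - c) - 2 * (y * v y) * 1) / ((y - c) * (y - c))
          = - 2 * v y - 2 * (y * v y) / ((y - c) * (y - c))"
        using alg[of "y - c" "v y" "y * v y"] y by simp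
      also have "\<dots> \<le> - 2 * v y" using y v_pos[of y] by simp
      also have "- 2 * v y \<le> s * (q y * v y)"
      proof -
        have "- 2 \<le> s * q y" using q_le[OF y(1)] s by (auto simp: abs_le_iff)
        hence "- 2 * v y \<le> (s * q y) * v y" using v_pos[OF y(1)] by (intro mult_right_mono) auto
        thus ?thesis by (simp add: mult.assoc)
      qed
      finally show "(2 * ((c - y) * v y) * (y - c) - 2 * (y * v y) * 1) / ((y - c) * (y - c))
            - s * (q y * v y) \<le> 0" by simp
    next
      have "((\<lambda>x. inverse (x - c)) \<longlongrightarrow> 0) at_top" by real_asymp
      from tendsto_diff[OF tendsto_mult[OF tendsto_mult_left[OF v_lim_top(2), of 2] this]
          tendsto_mult_left[OF U_lim_top, of s]]
      have "((\<lambda>x. (2 * (x * v x)) * inverse (x - c) - s * U x) \<longlongrightarrow> 0) at_top" by simp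
      thus "((\<lambda>x. 2 * (x * v x) / (x - c) - s * U x) \<longlongrightarrow> 0) at_top"
        by (simp add: divide_inverse)
    qed
    thus ?thesis using True by simp
  next
    case False
    hence x': "x < c" using x by simp
    have "2 * (x * v x) / (c - x) - s * U x \<ge> 0"
    proof (rule incr_from_zero_limit[where A = "\<lambda>x. 2 * (x * v x) / (c - x) - s * U x"
          and A' = "\<lambda>y. (2 * ((c - y) * v y) * (c - y) - 2 * (y * v y) * (-1)) / ((c - y) * (c - y))
            - s * (q y * v y)"])
      fix y assume "0 < y" "y \<le> x"
      hence y: "y > 0" "y < c" using x' by auto
      show "((\<lambda>x. 2 * (x * v x) / (c - x) - s * U x) has_real_derivative
         (2 * ((c - y) * v y) * (c - y) - 2 * (y * v y) * (-1)) / ((c - y) * (c - y))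
            - s * (q y * v y)) (at y)"
        using y by (intro DERIV_diff DERIV_divide DERIV_cmult xv_deriv U_deriv)
          (auto intro!: derivative_eq_intros)
      have "s * (q y * v y) \<le> 2 * v y"
      proof -
        have "s * q y \<le> 2" using q_le[OF y(1)] s by (auto simp: abs_le_iff)
        hence "(s * q y) * v y \<le> 2 * v y" using v_pos[OF y(1)] by (intro mult_right_mono) auto
        thus ?thesis by (simp add: mult.assoc)
      qed
      also have "2 * v y \<le> 2 * v y + 2 * (y * v y) / ((c - y) * (c - y))"
        using y v_pos[of y] by simp
      also have "\<dots> = (2 * ((c - y) * v y) * (c - y) - 2 * (y * v y) * (-1)) / ((c - y) * (c - y))"
        using y by (simp add: add_divide_distrib)
      finally show "(2 * ((c - y) * v y) * (c - y) - 2 * (y * v y) * (-1)) / ((c - y) * (c - y))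
            - s * (q y * v y) \<ge> 0" by simp
    next
      have "((\<lambda>x. 2 * (x * v x) / (c - x) - s * U x) \<longlongrightarrow> 2 * (0 * 0) / (c - 0) - s * 0) (at_right 0)"
        using r by (intro tendsto_diff tendsto_divide tendsto_mult tendsto_const tendsto_ident_at
            v_lim_0 U_lim_0) (auto simp: c_def)
      thus "((\<lambda>x. 2 * (x * v x) / (c - x) - s * U x) \<longlongrightarrow> 0) (at_right 0)" by simp
    qed (use x in auto)
    thus ?thesis using x' by simp
  qed
  \<comment> \<open>Cancelling the positive factor x v in \<open>key\<close> gives this away from
    \<open>c\<close>; at \<open>c\<close> itself, where the quotient in \<open>key\<close> breaks
    down, the left side is 0.\<close>
  have cg': "\<bar>(c - x) * g' x\<bar> \<le> 2" if x: "x > 0" for x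
  proof (cases "x = c")
    case False
    have "\<bar>U x\<bar> \<le> 2 * (x * v x) / \<bar>x - c\<bar>"
      using key[OF x False, of 1] key[OF x False, of "-1"] by (simp add: abs_le_iff)
    hence "\<bar>U x\<bar> * \<bar>x - c\<bar> \<le> 2 * (x * v x)"
      using False by (simp add: pos_le_divide_eq)
    also have "\<bar>U x\<bar> = x * \<bar>g' x\<bar> * v x"
      using x v_pos[OF x] by (simp add: U_def u_eq abs_mult)
    finally have "(x * v x) * (\<bar>g' x\<bar> * \<bar>x - c\<bar>) \<le> (x * v x) * 2"
      by (simp add: mult_ac)
    hence "\<bar>g' x\<bar> * \<bar>x - c\<bar> \<le> 2"
      using x v_pos[OF x] by (subst (asm) mult_le_cancel_left_pos) auto
    thus ?thesis by (simp add: abs_mult abs_minus_commute mult.commute)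
  qed auto
  have g''_le: "\<bar>x * g'' x\<bar> \<le> 4" if x: "x > 0" for x
  proof -
    have "x * g'' x = q x - (c - x) * g' x" using x by (simp add: g''_def q_def)
    thus ?thesis using q_le[OF x] cg'[OF x] by linarith
  qed
  have xg'_lim: "((\<lambda>x. x * g' x) \<longlongrightarrow> 0) (at_right 0)"
  proof (rule Lim_transform_eventually[OF u_lim])
    show "eventually (\<lambda>x. u x = x * g' x) (at_right 0)"
      using eventually_at_right_less[of 0] by eventually_elim (rule u_eq)
  qed
  show thesis by (rule that[of g g' g'']; fact g g'_deriv g''_le xg'_lim)
qed

text \<open>This is d times the error of replacing g' at a + d by the backward difference quotient
  over a step d, weighted by the endpoint. The start a = 0 must be included, as it is the step from
  the atom at 0 to the value p.\<close>

lemma stein_solution_difference: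
  obtains g g' where "r * g 0 = ht 0"
    "\<And>x. x > 0 \<Longrightarrow> x * g' x + (r - x) * g x = ht x"
    "\<And>x. x > 0 \<Longrightarrow> \<bar>g x\<bar> \<le> 1"
    "\<And>a d. a \<ge> 0 \<Longrightarrow> d > 0 \<Longrightarrow> \<bar>(a + d) * (g (a + d) - g a - d * g' (a + d))\<bar> \<le> 4 * d\<^sup>2"
proof -
  obtain g g' g'' where g: "(g \<longlongrightarrow> g 0) (at_right 0)" "((\<lambda>x. x * g' x) \<longlongrightarrow> 0) (at_right 0)"
    "r * g 0 = ht 0"
    "\<And>x. x > 0 \<Longrightarrow> (g has_real_derivative g' x) (at x)"
    "\<And>x. x > 0 \<Longrightarrow> (g' has_real_derivative g'' x) (at x)"
    "\<And>x. x > 0 \<Longrightarrow> x * g' x + (r - x) * g x = ht x"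
    "\<And>x. x > 0 \<Longrightarrow> \<bar>g x\<bar> \<le> 1"
    "\<And>x. x > 0 \<Longrightarrow> \<bar>x * g'' x\<bar> \<le> 4"
    by (rule stein_solution_second_order) blast
  have "\<bar>(a + d) * (g (a + d) - g a - d * g' (a + d))\<bar> \<le> 4 * d\<^sup>2" if a: "a \<ge> 0" and d: "d > 0" for a d
  proof -
    define b where "b = a + d"
    \<comment> \<open>\<open>\<theta>' y = - (y - a) g'' y\<close>, so the weight \<open>y - a\<close> absorbs the singularity of \<open>g''\<close> at $0$.\<close>
    define \<theta> where "\<theta> = (\<lambda>y. g y - (y - a) * g' y)"
    have \<theta>_deriv: "(\<theta> has_real_derivative - (y - a) * g'' y) (at y)" if "y > 0" for y
      unfolding \<theta>_def using that by (auto intro!: derivative_eq_intros g(4,5) simp: algebra_simps)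
    \<comment> \<open>For a = 0 the left endpoint is the origin, where no derivative is available;
      continuity of \<theta> there rests on x g'(x) tending to 0.\<close>
    have "continuous (at y within {a..b}) \<theta>" if y: "y \<in> {a..b}" for y
    proof (cases "y > 0")
      case True
      thus ?thesis
        by (rule continuous_at_imp_continuous_at_within[OF DERIV_isCont[OF \<theta>_deriv]])
    next
      case False
      hence [simp]: "y = 0" "a = 0" using y a by auto
      have "((\<lambda>y. g y - y * g' y) \<longlongrightarrow> g 0 - 0) (at_right 0)" by (intro tendsto_intros g)
      thus ?thesis using d
        by (simp add: continuous_within \<theta>_def b_def at_within_Icc_at_right)
    qed
    hence cont: "continuous_on {a..b} \<theta>" by (simp add: continuous_on_eq_continuous_within)
    have bound: "\<bar>- (y - a) * g'' y\<bar> \<le> 4 * d / b" if y: "a < y" "y < b" for y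
    proof -
      have "\<bar>- (y - a) * g'' y\<bar> = (y - a) / y * \<bar>y * g'' y\<bar>"
        using y a by (simp add: abs_mult)
      also have "\<dots> \<le> (d / b) * 4"
      proof (intro mult_mono g(8))
        have "(y - a) * b \<le> d * y"
          using mult_left_mono[of y b a] y a by (simp add: b_def algebra_simps)
        thus "(y - a) / y \<le> d / b" using y a by (simp add: field_simps)
      qed (use y a d b_def in auto)
      also have "\<dots> = 4 * d / b" by simp
      finally show ?thesis .
    qed
    have s: "s * \<theta> b \<le> s * \<theta> a + 4 * d / b * d" if s: "s \<in> {1, -1}" for s
    proof -
      have "s * \<theta> b - 4 * d / b * b \<le> s * \<theta> a - 4 * d / b * a"
      proof (rule DERIV_nonpos_imp_decreasing_open[of a b "\<lambda>y. s * \<theta> y - 4 * d / b * y"])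
        fix y assume y: "a < y" "y < b"
        have "((\<lambda>y. s * \<theta> y - 4 * d / b * y) has_real_derivative
            s * (- (y - a) * g'' y) - 4 * d / b * 1) (at y)"
          using y a by (intro DERIV_diff DERIV_cmult \<theta>_deriv DERIV_ident) auto
        moreover have "s * (- (y - a) * g'' y) - 4 * d / b * 1 \<le> 0"
          using bound[OF y] s by (auto simp: abs_le_iff)
        ultimately show "\<exists>z. ((\<lambda>y. s * \<theta> y - 4 * d / b * y) has_real_derivative z) (at y) \<and> z \<le> 0"
          by blast
      next
        show "continuous_on {a..b} (\<lambda>y. s * \<theta> y - 4 * d / b * y)"
          by (intro continuous_on_diff continuous_on_mult_left cont continuous_on_id)
      qed (use d in \<open>simp add: b_def\<close>)
      thus ?thesis by (simp add: b_def ring_distribs add_divide_distrib)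
    qed
    have "\<bar>\<theta> b - \<theta> a\<bar> \<le> 4 * d / b * d"
      using s[of 1] s[of "-1"] by (simp add: abs_le_iff)
    hence "b * \<bar>\<theta> b - \<theta> a\<bar> \<le> b * (4 * d / b * d)"
      using a d by (intro mult_left_mono) (auto simp: b_def)
    also have "\<dots> = 4 * d\<^sup>2" using a d by (simp add: b_def power2_eq_square)
    also have "b * \<bar>\<theta> b - \<theta> a\<bar> = \<bar>b * (g b - g a - d * g' b)\<bar>"
    proof -
      have "\<theta> b - \<theta> a = g b - g a - d * g' b" by (simp add: \<theta>_def b_def)
      thus ?thesis using a d by (simp add: abs_mult b_def)
    qed
    finally show ?thesis by (simp only: b_def)
  qed
  note diff = this
  show thesis by (rule that[of g g']; fact g(3,6,7) diff)
qed

end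

section \<open>The scaled negative binomial law\<close>

locale neg_binomial_law = prob_space M for M :: "'a measure" +
  fixes T :: "'a \<Rightarrow> nat" and \<kappa> p :: real
  assumes \<kappa>: "\<kappa> > 0" and p: "0 < p" "p < 1" and T: "neg_binomial_rv M T \<kappa> p"
begin

definition "q n = Gamma (\<kappa> + real n) / (Gamma \<kappa> * fact n) * p powr \<kappa> * (1 - p) ^ n"
definition "r = \<kappa> * (1 - p)"
definition "W = (\<lambda>\<omega>. p * real (T \<omega>))"

lemma r_pos: "r > 0"
  using \<kappa> p by (simp add: r_def)

lemma T_measurable [measurable]: "T \<in> measurable M (count_space UNIV)"
  using T by (simp add: neg_binomial_rv_def)

lemma W_measurable [measurable]: "W \<in> borel_measurable M"
  unfolding W_def by measurable

lemma q_nonneg: "q n \<ge> 0"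
  using \<kappa> p Gamma_real_pos[of "\<kappa> + real n"] Gamma_real_pos[of \<kappa>]
  by (simp add: q_def)

lemma q_0: "q 0 = p powr \<kappa>"
  using Gamma_real_pos[OF \<kappa>] by (simp add: q_def)

lemma q_Suc: "real (Suc n) * q (Suc n) = (1 - p) * (\<kappa> + real n) * q n"
proof -
  have "Gamma (\<kappa> + real n + 1) = (\<kappa> + real n) * Gamma (\<kappa> + real n)"
    using \<kappa> by (intro Gamma_plus1) (auto elim!: nonpos_Ints_cases)
  thus ?thesis by (simp add: q_def divide_simps add_ac mult_ac)
qed

lemma measure_T: "prob {\<omega> \<in> space M. T \<omega> = n} = q n"
  using T by (simp add: neg_binomial_rv_def q_def)

lemma distr_T: "distr M (count_space UNIV) T = density (count_space UNIV) (\<lambda>n. ennreal (q n))"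
proof (rule measure_eqI_countable[where A = UNIV])
  fix n :: nat
  have "emeasure (distr M (count_space UNIV) T) {n} = emeasure M {\<omega> \<in> space M. T \<omega> = n}"
    by (subst emeasure_distr) (auto intro!: arg_cong[where f = "emeasure M"])
  also have "\<dots> = ennreal (q n)" by (simp add: emeasure_eq_measure measure_T)
  finally show "emeasure (distr M (count_space UNIV) T) {n} =
      emeasure (density (count_space UNIV) (\<lambda>n. ennreal (q n))) {n}"
    by (subst emeasure_density) (auto simp: nn_integral_count_space_indicator[symmetric]
        nn_integral_count_space_finite)
qed auto

lemma integral_W:
  fixes f :: "real \<Rightarrow> real"
  assumes [measurable]: "f \<in> borel_measurable borel"
    and summ: "summable (\<lambda>n. \<bar>f (p * real n)\<bar> * q n)"
  shows "(\<lambda>n. f (p * real n) * q n) sums integral\<^sup>L (distr M borel W) f"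
    and "integrable (distr M borel W) f"
proof -
  have int: "integrable (count_space UNIV) (\<lambda>n. q n *\<^sub>R f (p * real n))"
    using summ q_nonneg by (simp add: integrable_count_space_nat_iff abs_mult mult.commute)
  have eq: "distr M borel W = distr (distr M (count_space UNIV) T) borel (\<lambda>n. p * real n)"
    by (subst distr_distr) (auto simp: W_def o_def)
  have "integral\<^sup>L (distr M borel W) f =
      integral\<^sup>L (density (count_space UNIV) (\<lambda>n. ennreal (q n))) (\<lambda>n. f (p * real n))"
    unfolding eq by (subst integral_distr) (simp_all add: distr_T)
  also have "\<dots> = (\<integral>n. q n *\<^sub>R f (p * real n) \<partial>count_space UNIV)"
    by (subst integral_density) (auto simp: q_nonneg)
  finally show "(\<lambda>n. f (p * real n) * q n) sums integral\<^sup>L (distr M borel W) f"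
    using sums_integral_count_space_nat[OF int] by (simp add: mult.commute)
  show "integrable (distr M borel W) f" unfolding eq
    using int by (subst integrable_distr_eq) (simp_all add: distr_T integrable_density q_nonneg)
qed

lemma q_sums: "q sums 1"
proof -
  interpret N: prob_space "distr M (count_space UNIV) T" by (rule prob_space_distr) auto
  have "(\<lambda>n. N.prob {n}) sums N.prob (\<Union>n. {n})"
    by (rule N.finite_measure_UNION) (auto simp: disjoint_family_on_def)
  moreover have "N.prob {n} = q n" for n
    by (subst measure_distr) (auto simp: measure_T[symmetric] intro!: arg_cong[where f = prob])
  ultimately show ?thesis using N.prob_space by simp
qed

lemma q_summable: "summable q"
  using q_sums by (rule sums_summable)

lemma nq_summable: "summable (\<lambda>n. real n * q n)"
proof (rule summable_ratio_test)
  \<comment> \<open>Ratios of consecutive terms tend to 1 - p; half of the gap p absorbs the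
    contribution of \<kappa> once n \<ge> 2 \<kappa> / p.\<close>
  show "1 - p / 2 < 1" using p by simp
  fix n assume n: "n \<ge> nat \<lceil>2 * \<kappa> / p\<rceil>"
  hence "2 * \<kappa> / p \<le> real n" by linarith
  hence "2 * \<kappa> \<le> p * real n" using p by (simp add: field_simps)
  moreover have "(1 - p) * \<kappa> \<le> 1 * \<kappa>" using p \<kappa> by (intro mult_right_mono) auto
  ultimately have "(1 - p) * (\<kappa> + real n) \<le> (1 - p / 2) * real n"
    by (simp add: algebra_simps)
  hence "(1 - p) * (\<kappa> + real n) * q n \<le> (1 - p / 2) * real n * q n"
    using q_nonneg by (rule mult_right_mono)
  thus "norm (real (Suc n) * q (Suc n)) \<le> (1 - p / 2) * norm (real n * q n)"
    using q_nonneg[of n] q_nonneg[of "Suc n"] by (simp only: q_Suc[symmetric]) (simp add: mult_ac)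
qed

lemma bounded_mult_summable:
  fixes f :: "nat \<Rightarrow> real"
  assumes "\<And>n. \<bar>f n\<bar> \<le> a + b * real n"
  shows "summable (\<lambda>n. \<bar>f n\<bar> * q n)" "summable (\<lambda>n. f n * q n)"
proof -
  have s: "summable (\<lambda>n. a * q n + b * (real n * q n))"
    by (intro summable_add summable_mult q_summable nq_summable)
  have le: "\<bar>f n\<bar> * q n \<le> a * q n + b * (real n * q n)" for n
    using mult_right_mono[OF assms[of n] q_nonneg[of n]] by (simp add: algebra_simps)
  show "summable (\<lambda>n. \<bar>f n\<bar> * q n)"
    by (rule summable_comparison_test'[OF s, of 0]) (use le q_nonneg in \<open>auto simp: abs_mult\<close>)
  show "summable (\<lambda>n. f n * q n)"
    by (rule summable_comparison_test'[OF s, of 0]) (use le q_nonneg in \<open>auto simp: abs_mult\<close>)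
qed

text \<open>For G n = g(p n) and x = p n the bracket is p (x g'(x) + (r - x) g(x)) with p g'(x)
  replaced by g(x) - g(x - p). Comparison with the Stein equation thus leaves only the error of this
  replacement.\<close>

lemma stein_identity:
  fixes G :: "nat \<Rightarrow> real"
  assumes "\<And>n. \<bar>G n\<bar> \<le> K"
  shows "(\<lambda>n. (p * (r - p * real n) * G n + p * real n * (G n - G (n - 1))) * q n) sums 0"
proof -
  \<comment> \<open>The weight recursion makes the series telescope; \<open>G (0 - 1) = G 0\<close> is multiplied by $0$.\<close>
  define B where "B n = p * real n * q n * G (n - 1)" for n
  have "B \<longlonglongrightarrow> 0"
  proof (rule Lim_null_comparison)
    have "(\<lambda>n. p * (real n * q n) * K) \<longlonglongrightarrow> p * 0 * K"
      by (intro tendsto_intros summable_LIMSEQ_zero nq_summable)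
    thus "(\<lambda>n. p * (real n * q n) * K) \<longlonglongrightarrow> 0" by simp
    show "eventually (\<lambda>n. norm (B n) \<le> p * (real n * q n) * K) sequentially"
    proof (intro always_eventually allI)
      fix n
      have "norm (B n) = p * (real n * q n) * \<bar>G (n - 1)\<bar>"
        using p q_nonneg[of n] by (simp add: B_def abs_mult)
      also have "\<dots> \<le> p * (real n * q n) * K"
        using p q_nonneg[of n] assms by (intro mult_left_mono) auto
      finally show "norm (B n) \<le> p * (real n * q n) * K" .
    qed
  qed
  from telescope_sums[OF this] have "(\<lambda>n. B (Suc n) - B n) sums 0" by (simp add: B_def)
  also have "(\<lambda>n. B (Suc n) - B n) =
      (\<lambda>n. (p * (r - p * real n) * G n + p * real n * (G n - G (n - 1))) * q n)"
  proof
    fix n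
    have "B (Suc n) = p * (real (Suc n) * q (Suc n)) * G n" by (simp add: B_def)
    also have "\<dots> = p * ((1 - p) * (\<kappa> + real n) * q n) * G n" by (simp only: q_Suc)
    finally show "B (Suc n) - B n =
        (p * (r - p * real n) * G n + p * real n * (G n - G (n - 1))) * q n"
      by (simp add: B_def r_def algebra_simps)
  qed
  finally show ?thesis .
qed

text \<open>The constant function 1 kills the difference term in \<open>stein_identity\<close>,
  which leaves E(r - p T) = 0.\<close>

lemma mean_sums: "(\<lambda>n. real n * q n) sums (r / p)"
proof -
  have "(\<lambda>n. (p * (r - p * real n)) * q n) sums 0"
    using stein_identity[of "\<lambda>_. 1" 1] by simp
  moreover have "(\<lambda>n. p * r * q n) sums (p * r * 1)"
    by (intro sums_mult q_sums)
  ultimately have "(\<lambda>n. p * r * q n - (p * (r - p * real n)) * q n) sums (p * r * 1 - 0)"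
    by (intro sums_diff)
  hence "(\<lambda>n. (p * r * q n - (p * (r - p * real n)) * q n) / p\<^sup>2) sums ((p * r * 1 - 0) / p\<^sup>2)"
    by (rule sums_divide)
  thus ?thesis using p by (simp add: algebra_simps power2_eq_square)
qed

section \<open>The probability of a positive value\<close>

definition "pos_prob = 1 - q 0"

lemma pos_prob_sums: "(\<lambda>n. (if n = 0 then 0 else 1) * q n) sums pos_prob"
proof -
  have "(\<lambda>n. q n - (if n = 0 then q 0 else 0)) sums (1 - q 0)"
    by (intro sums_diff q_sums sums_If_finite[where P = "\<lambda>n. n = 0", simplified])
       (use sums_single[of 0 "\<lambda>_. q 0"] in simp)
  also have "(\<lambda>n. q n - (if n = 0 then q 0 else 0)) = (\<lambda>n. (if n = 0 then 0 else 1) * q n)"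
    by auto
  finally show ?thesis by (simp add: pos_prob_def)
qed

text \<open>The last bound is Markov's inequality with the mean r / p.\<close>

lemma pos_prob_bounds: "0 \<le> pos_prob" "pos_prob \<le> 1" "pos_prob \<le> r / p"
proof -
  show "pos_prob \<le> 1" using q_nonneg[of 0] by (simp add: pos_prob_def)
  show "pos_prob \<le> r / p"
  proof (rule sums_le[OF _ pos_prob_sums mean_sums])
    show "(if n = 0 then 0 else 1) * q n \<le> real n * q n" for n
      using q_nonneg[of n] by (intro mult_right_mono) auto
  qed
  show "0 \<le> pos_prob"
    by (rule sums_le[OF _ sums_zero pos_prob_sums]) (use q_nonneg in auto)
qed

text \<open>For small p the bound r / p is too large. Since 1 - p^\<kappa> \<le> - \<kappa> ln p,
  the growth in 1 / p is only logarithmic, and the factor r is kept.\<close>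

lemma pos_prob_le_ln: "pos_prob \<le> r * (- ln p / (1 - p))"
proof -
  have "1 + \<kappa> * ln p \<le> exp (\<kappa> * ln p)" by (rule exp_ge_add_one_self)
  also have "\<dots> = q 0" using p by (simp add: q_0 powr_def)
  finally show ?thesis using p by (simp add: pos_prob_def r_def)
qed

text \<open>Subtracting \<open>stein_identity\<close> from p times the centred expectation leaves,
  for n > 0, the difference error with a = p (n - 1) and d = p, which is at most 4 p^2; one factor p
  is divided out at the end.\<close>

lemma smooth_bound:
  fixes h h' :: "real \<Rightarrow> real"
  assumes h: "\<And>x. (h has_real_derivative h' x) (at x)" "\<And>x. \<bar>h' x\<bar> \<le> 1"
  shows "\<bar>integral\<^sup>L (distr M borel W) h - integral\<^sup>L (gamma_distribution r 1) h\<bar> \<le> 4 * p * pos_prob"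
proof -
  interpret gamma_stein r h h' by unfold_locales (use r_pos h in auto)
  obtain g g' where g: "r * g 0 = ht 0"
    "\<And>x. x > 0 \<Longrightarrow> x * g' x + (r - x) * g x = ht x"
    "\<And>x. x > 0 \<Longrightarrow> \<bar>g x\<bar> \<le> 1"
    "\<And>a d. a \<ge> 0 \<Longrightarrow> d > 0 \<Longrightarrow> \<bar>(a + d) * (g (a + d) - g a - d * g' (a + d))\<bar> \<le> 4 * d\<^sup>2"
    by (rule stein_solution_difference) blast
  define E where "E = integral\<^sup>L (distr M borel W) h - integral\<^sup>L (gamma_distribution r 1) h"
  define G where "G n = g (p * real n)" for n
  \<comment> \<open>The bound on g covers positive arguments only. Any constant serves, since it
    only has to make the telescoping boundary term vanish.\<close>
  have G: "\<bar>G n\<bar> \<le> max 1 \<bar>g 0\<bar>" for n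
    using g(3)[of "p * real n"] p by (cases "n = 0") (auto simp: G_def)
  have "\<bar>h (p * real n)\<bar> \<le> \<bar>h 0\<bar> + p * real n" for n
    using h_lipschitz[of "p * real n" 0] p by simp
  hence "summable (\<lambda>n. \<bar>h (p * real n)\<bar> * q n)" by (rule bounded_mult_summable)
  hence "(\<lambda>n. h (p * real n) * q n) sums integral\<^sup>L (distr M borel W) h"
    by (intro integral_W) auto
  from sums_diff[OF this sums_mult[OF q_sums, of "integral\<^sup>L (gamma_distribution r 1) h"]]
  have "(\<lambda>n. ht (p * real n) * q n) sums E" by (simp add: E_def ht_def algebra_simps)
  from sums_diff[OF sums_mult[OF this, of p] stein_identity[OF G]]
  have sums: "(\<lambda>n. p * (ht (p * real n) * q n) -
      (p * (r - p * real n) * G n + p * real n * (G n - G (n - 1))) * q n) sums (p * E)"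
    by simp
  have le: "\<bar>p * (ht (p * real n) * q n) -
      (p * (r - p * real n) * G n + p * real n * (G n - G (n - 1))) * q n\<bar>
      \<le> 4 * p\<^sup>2 * ((if n = 0 then 0 else 1) * q n)" for n
  proof (cases n)
    \<comment> \<open>Here \<open>r * g 0 = ht 0\<close> cancels the summand exactly; this is what
      produces P(T \<ge> 1) instead of 1.\<close>
    case 0
    thus ?thesis by (simp add: G_def g(1))
  next
    case (Suc m)
    define x where "x = p * real n"
    have x: "x = p * real m + p" using Suc by (simp add: x_def algebra_simps)
    have x_pos: "x > 0" using Suc p by (simp add: x_def)
    have "p * (ht (p * real n) * q n) -
      (p * (r - p * real n) * G n + p * real n * (G n - G (n - 1))) * q n =
      - (x * (g x - g (p * real m) - p * g' x)) * q n"
      using Suc unfolding G_def x_def[symmetric] g(2)[OF x_pos, symmetric]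
      by (simp add: algebra_simps)
    also have "\<bar>\<dots>\<bar> \<le> 4 * p\<^sup>2 * q n"
      unfolding abs_mult abs_minus_cancel using g(4)[of "p * real m" p] p q_nonneg[of n]
      by (simp add: x abs_mult mult_right_mono)
    finally show ?thesis using Suc by simp
  qed
  have bsum: "(\<lambda>n. 4 * p\<^sup>2 * ((if n = 0 then 0 else 1) * q n)) sums (4 * p\<^sup>2 * pos_prob)"
    by (intro sums_mult pos_prob_sums)
  have "p * E \<le> 4 * p\<^sup>2 * pos_prob"
    by (rule sums_le[OF _ sums bsum]) (use le abs_le_iff in blast)
  moreover have "- (p * E) \<le> 4 * p\<^sup>2 * pos_prob"
    by (rule sums_le[OF _ sums_minus[OF sums] bsum]) (use le abs_le_iff in blast)
  ultimately have "\<bar>p * E\<bar> \<le> 4 * p\<^sup>2 * pos_prob" by (simp only: abs_le_iff)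
  hence "p * \<bar>E\<bar> \<le> p * (4 * p * pos_prob)"
    using p by (simp add: abs_mult power2_eq_square mult_ac)
  thus ?thesis using p unfolding E_def by (subst (asm) mult_le_cancel_left_pos)
qed

end

section \<open>Lipschitz test functions and smoothing of distribution functions\<close>

lemma lipschitz_1_abs:
  fixes f :: "real \<Rightarrow> real"
  assumes "1-lipschitz_on UNIV f"
  shows "\<bar>f x - f y\<bar> \<le> \<bar>x - y\<bar>"
  using lipschitz_onD[OF assms, of x y] by (simp add: dist_real_def)

text \<open>The mean of f over [x, x + d] has a difference quotient of f as its derivative, hence
  keeps the Lipschitz constant; by the mean value theorem it equals a value of f at distance less
  than d.\<close>

lemma smooth_lipschitz_approx:
  fixes f :: "real \<Rightarrow> real"
  assumes lip: "1-lipschitz_on UNIV f" and d: "d > 0"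
  obtains h h' where "\<And>x. (h has_real_derivative h' x) (at x)" "\<And>x. \<bar>h' x\<bar> \<le> 1"
    "\<And>x. \<bar>h x - f x\<bar> \<le> d"
proof -
  have cont: "continuous_on A f" for A
    using lipschitz_on_continuous_on[OF lip] by (rule continuous_on_subset) auto
  define F where "F u = (LBINT y=0..ereal u. f y)" for u
  have F: "(F has_real_derivative f x) (at x)" for x
  proof -
    define b where "b = \<bar>x\<bar> + 1"
    have "(F has_vector_derivative f x) (at x within {- b..b})"
      unfolding F_def using interval_integral_FTC2[of "- b" 0 b f x] cont
      by (auto simp: b_def zero_ereal_def)
    thus ?thesis
      by (subst (asm) at_within_interior)
        (auto simp: b_def has_real_derivative_iff_has_vector_derivative)
  qed
  define h where "h x = (F (x + d) - F x) / d" for x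
  define h' where "h' x = (f (x + d) - f x) / d" for x
  have "(h has_real_derivative h' x) (at x)" for x
  proof -
    have "((\<lambda>x. F (x + d)) has_real_derivative f (x + d)) (at x)"
      using F[of "x + d"] by (simp add: DERIV_shift)
    from DERIV_cdivide[OF DERIV_diff[OF this F[of x]], of d] show ?thesis
      unfolding h_def h'_def .
  qed
  moreover have "\<bar>h' x\<bar> \<le> 1" for x
    using lipschitz_1_abs[OF lip, of "x + d" x] d by (simp add: h'_def)
  moreover have "\<bar>h x - f x\<bar> \<le> d" for x
  proof -
    obtain z where z: "x < z" "z < x + d" "F (x + d) - F x = (x + d - x) * f z"
      using MVT2[of x "x + d" F f] d F by auto
    hence "h x = f z" using d by (simp add: h_def)
    thus ?thesis using lipschitz_1_abs[OF lip, of z x] z by simp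
  qed
  ultimately show thesis by (rule that)
qed

context neg_binomial_law
begin

lemma lipschitz_integrable:
  fixes f :: "real \<Rightarrow> real"
  assumes lip: "\<And>x y. \<bar>f x - f y\<bar> \<le> \<bar>x - y\<bar>"
  shows "f \<in> borel_measurable borel" "integrable (distr M borel W) f"
    "integrable (gamma_distribution r 1) f"
proof -
  have "1-lipschitz_on UNIV f" by (rule lipschitz_onI) (use lip in \<open>auto simp: dist_real_def\<close>)
  thus [measurable]: "f \<in> borel_measurable borel"
    by (intro borel_measurable_continuous_onI lipschitz_on_continuous_on)
  have le: "\<bar>f x\<bar> \<le> \<bar>f 0\<bar> + \<bar>x\<bar>" for x using lip[of x 0] by simp
  have "\<bar>f (p * real n)\<bar> \<le> \<bar>f 0\<bar> + p * real n" for n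
    using le[of "p * real n"] p by simp
  hence "summable (\<lambda>n. \<bar>f (p * real n)\<bar> * q n)" by (rule bounded_mult_summable)
  thus "integrable (distr M borel W) f" by (intro integral_W) auto
  interpret G: prob_space "gamma_distribution r 1"
    by (rule prob_space_gamma_distribution[OF r_pos])
  have "integrable (gamma_distribution r 1) (\<lambda>x. \<bar>f 0\<bar> + \<bar>x\<bar>)"
    using integrable_gamma_distribution_id[OF r_pos] by auto
  thus "integrable (gamma_distribution r 1) f"
  proof (rule Bochner_Integration.integrable_bound)
    have "norm (f x) \<le> norm (\<bar>f 0\<bar> + \<bar>x\<bar>)" for x using le[of x] by simp
    thus "AE x in gamma_distribution r 1. norm (f x) \<le> norm (\<bar>f 0\<bar> + \<bar>x\<bar>)" by simp
  qed measurable
qed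

text \<open>The smooth bound does not depend on the smoothing width, so uniform approximation
  carries it over to every 1-Lipschitz function.\<close>

lemma lipschitz_bound:
  fixes f :: "real \<Rightarrow> real"
  assumes lip: "1-lipschitz_on UNIV f"
  shows "\<bar>integral\<^sup>L (distr M borel W) f - integral\<^sup>L (gamma_distribution r 1) f\<bar> \<le> 4 * p * pos_prob"
proof (rule field_le_epsilon)
  fix e :: real assume "e > 0"
  then obtain h h' where h: "\<And>x. (h has_real_derivative h' x) (at x)" "\<And>x. \<bar>h' x\<bar> \<le> 1"
    "\<And>x. \<bar>h x - f x\<bar> \<le> e / 2"
    using smooth_lipschitz_approx[OF lip, of "e / 2"] by auto
  have lh: "\<bar>h x - h y\<bar> \<le> \<bar>x - y\<bar>" for x y
    using field_differentiable_bound[of UNIV h h' 1 x y] h by simp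
  note int = lipschitz_integrable[OF lipschitz_1_abs[OF lip]] lipschitz_integrable[of h, OF lh]
  have diff: "\<bar>integral\<^sup>L N h - integral\<^sup>L N f\<bar> \<le> e / 2"
    if "prob_space N" and i: "integrable N h" "integrable N f" for N
  proof -
    interpret N: prob_space N by fact
    have "\<bar>integral\<^sup>L N h - integral\<^sup>L N f\<bar> = \<bar>integral\<^sup>L N (\<lambda>x. h x - f x)\<bar>"
      using i by simp
    also have "\<dots> \<le> (\<integral>x. \<bar>h x - f x\<bar> \<partial>N)" by (rule integral_abs_bound)
    also have "\<dots> \<le> (\<integral>x. e / 2 \<partial>N)" using i h(3) by (intro integral_mono) auto
    finally show ?thesis by (simp add: N.prob_space)
  qed
  have "\<bar>integral\<^sup>L (distr M borel W) h - integral\<^sup>L (distr M borel W) f\<bar> \<le> e / 2"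
    by (intro diff prob_space_distr int) auto
  moreover have "\<bar>integral\<^sup>L (gamma_distribution r 1) h - integral\<^sup>L (gamma_distribution r 1) f\<bar> \<le> e / 2"
    by (intro diff prob_space_gamma_distribution r_pos int)
  ultimately show "\<bar>integral\<^sup>L (distr M borel W) f - integral\<^sup>L (gamma_distribution r 1) f\<bar>
      \<le> 4 * p * pos_prob + e"
    using smooth_bound[OF h(1,2)] by linarith
qed

lemma wasserstein_bound:
  "wasserstein_dist (distr M borel W) (gamma_distribution r 1) \<le> ereal (4 * p * pos_prob)"
  unfolding wasserstein_dist_def by (rule SUP_least) (use lipschitz_bound in simp)

end

section \<open>Ramps and distribution functions\<close>

lemma nn_integral_level_sets:
  fixes k :: "real \<Rightarrow> real"
  assumes "sigma_finite_measure N" and [measurable_cong]: "sets N = sets borel"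
    and [measurable]: "k \<in> borel_measurable borel"
  shows "(\<integral>\<^sup>+x. emeasure lborel {s \<in> {0..e}. x \<le> k s} \<partial>N) =
           (\<integral>\<^sup>+s. emeasure N {..k s} * indicator {0..e} s \<partial>lborel)"
proof -
  interpret N: sigma_finite_measure N by fact
  interpret pair_sigma_finite N lborel ..
  let ?f = "\<lambda>x s. indicator {0..e} s * indicator {..k s} x :: ennreal"
  have m: "case_prod ?f \<in> borel_measurable (N \<Otimes>\<^sub>M lborel)"
    unfolding indicator_def atMost_iff by measurable
  have "(\<integral>\<^sup>+x. emeasure lborel {s \<in> {0..e}. x \<le> k s} \<partial>N) = (\<integral>\<^sup>+x. \<integral>\<^sup>+s. ?f x s \<partial>lborel \<partial>N)"
  proof (rule nn_integral_cong)
    fix x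
    have "(\<integral>\<^sup>+s. ?f x s \<partial>lborel) = (\<integral>\<^sup>+s. indicator {s \<in> {0..e}. x \<le> k s} s \<partial>lborel)"
      by (intro nn_integral_cong) (auto simp: indicator_def)
    thus "emeasure lborel {s \<in> {0..e}. x \<le> k s} = (\<integral>\<^sup>+s. ?f x s \<partial>lborel)"
      by (simp add: nn_integral_indicator)
  qed
  also have "\<dots> = (\<integral>\<^sup>+s. \<integral>\<^sup>+x. ?f x s \<partial>N \<partial>lborel)" by (rule Fubini'[OF m, symmetric])
  also have "\<dots> = (\<integral>\<^sup>+s. emeasure N {..k s} * indicator {0..e} s \<partial>lborel)"
    by (intro nn_integral_cong) (simp add: nn_integral_cmult mult.commute assms(2))
  finally show ?thesis .
qed

text \<open>By Tonelli, a ramp of height e integrates to the integral over s in [0, e] of the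
  distribution function at z + s or at z - s. Comparison with e times its value at z costs the
  integral of c s^a, so averaging gains a factor 1 / (a + 1) over the crude cost; the case r < 1
  uses this gain.\<close>

lemma smoothing_cdf:
  fixes N :: "real measure"
  assumes "prob_space N" and sets: "sets N = sets borel" and e: "e > 0" and a: "a > 0" and c: "c \<ge> 0"
    and modulus: "\<And>x s. s \<ge> 0 \<Longrightarrow> cdf N (x + s) \<le> cdf N x + c * s powr a"
  shows "(\<integral>x. max 0 (min e (z + e - x)) \<partial>N) \<le> e * cdf N z + c * e powr (a + 1) / (a + 1)"
    and "e * cdf N z \<le> (\<integral>x. max 0 (min e (z - x)) \<partial>N) + c * e powr (a + 1) / (a + 1)"
proof -
  interpret N: prob_space N by fact
  note [measurable_cong] = sets
  have em: "emeasure N {..x} = ennreal (cdf N x)" for x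
    by (simp add: cdf_def N.emeasure_eq_measure)
  have "((\<lambda>s. c * s powr a) has_integral c * (e powr (a + 1) / (a + 1))) {0..e}"
    using a e by (intro has_integral_mult_right has_integral_powr_from_0) auto
  from nn_integral_has_integral_lebesgue'[OF _ this] c
  have powr_int: "(\<integral>\<^sup>+s. ennreal (c * s powr a) * indicator {0..e} s \<partial>lborel) =
      ennreal (c * e powr (a + 1) / (a + 1))" by simp
  have const_int: "(\<integral>\<^sup>+s. ennreal b * indicator {0..e} s \<partial>lborel) = ennreal (e * b)" if "b \<ge> 0" for b
    using e that by (simp add: nn_integral_cmult ennreal_mult[symmetric] mult.commute)
  have conv: "(\<integral>\<^sup>+x. ennreal (max 0 (min e (t - x))) \<partial>N) = ennreal (\<integral>x. max 0 (min e (t - x)) \<partial>N)" for t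
    by (intro nn_integral_eq_integral N.integrable_const_bound[where B = e]) (use e in auto)
  have R: "0 \<le> c * e powr (a + 1) / (a + 1)" using c a by simp
  have pos: "0 \<le> cdf N x" for x by (simp add: cdf_def)
  have [measurable]: "cdf N \<in> borel_measurable borel"
    by (rule borel_measurable_mono) (auto simp: mono_def cdf_def sets intro!: N.finite_measure_mono)
  have "ennreal (\<integral>x. max 0 (min e (z + e - x)) \<partial>N) = (\<integral>\<^sup>+x. emeasure lborel {s \<in> {0..e}. x \<le> z + s} \<partial>N)"
    unfolding conv[symmetric]
  proof (rule nn_integral_cong)
    fix x
    have "{s \<in> {0..e}. x \<le> z + s} = {max 0 (x - z)..e}" by auto
    thus "ennreal (max 0 (min e (z + e - x))) = emeasure lborel {s \<in> {0..e}. x \<le> z + s}"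
      using e by (simp add: emeasure_lborel_Icc_eq) (auto simp: max_def min_def ennreal_neg)
  qed
  also have "\<dots> = (\<integral>\<^sup>+s. emeasure N {..z + s} * indicator {0..e} s \<partial>lborel)"
    by (rule nn_integral_level_sets) (use N.sigma_finite_measure_axioms sets in auto)
  also have "\<dots> \<le> (\<integral>\<^sup>+s. ennreal (cdf N z) * indicator {0..e} s + ennreal (c * s powr a) * indicator {0..e} s \<partial>lborel)"
    by (intro nn_integral_mono)
       (auto simp: em indicator_def ennreal_plus[symmetric] pos c simp del: ennreal_plus intro!: ennreal_leI modulus)
  also have "\<dots> = ennreal (e * cdf N z + c * e powr (a + 1) / (a + 1))"
    using R pos e by (subst nn_integral_add) (auto simp: const_int powr_int)
  finally show "(\<integral>x. max 0 (min e (z + e - x)) \<partial>N) \<le> e * cdf N z + c * e powr (a + 1) / (a + 1)"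
    using R pos[of z] e by (subst (asm) ennreal_le_iff) auto
  have "ennreal (e * cdf N z) = (\<integral>\<^sup>+s. ennreal (cdf N z) * indicator {0..e} s \<partial>lborel)"
    by (simp add: const_int pos)
  also have "\<dots> \<le> (\<integral>\<^sup>+s. emeasure N {..z - s} * indicator {0..e} s + ennreal (c * s powr a) * indicator {0..e} s \<partial>lborel)"
  proof (rule nn_integral_mono)
    fix s
    have "cdf N z \<le> cdf N (z - s) + c * s powr a" if "s \<ge> 0"
      using modulus[OF that, of "z - s"] by simp
    thus "ennreal (cdf N z) * indicator {0..e} s \<le>
        emeasure N {..z - s} * indicator {0..e} s + ennreal (c * s powr a) * indicator {0..e} s"
      by (auto simp: em indicator_def ennreal_plus[symmetric] pos c simp del: ennreal_plus intro!: ennreal_leI)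
  qed
  also have "\<dots> = (\<integral>\<^sup>+s. emeasure N {..z - s} * indicator {0..e} s \<partial>lborel) + ennreal (c * e powr (a + 1) / (a + 1))"
    by (subst nn_integral_add) (auto simp: powr_int em)
  also have "(\<integral>\<^sup>+s. emeasure N {..z - s} * indicator {0..e} s \<partial>lborel) =
      (\<integral>\<^sup>+x. emeasure lborel {s \<in> {0..e}. x \<le> z - s} \<partial>N)"
    by (rule nn_integral_level_sets[symmetric]) (use N.sigma_finite_measure_axioms sets in auto)
  also have "\<dots> = ennreal (\<integral>x. max 0 (min e (z - x)) \<partial>N)"
    unfolding conv[symmetric]
  proof (rule nn_integral_cong)
    fix x
    have "{s \<in> {0..e}. x \<le> z - s} = {0..min e (z - x)}" by auto
    thus "emeasure lborel {s \<in> {0..e}. x \<le> z - s} = ennreal (max 0 (min e (z - x)))"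
      using e by (simp add: emeasure_lborel_Icc_eq) (auto simp: max_def min_def ennreal_neg)
  qed
  finally show "e * cdf N z \<le> (\<integral>x. max 0 (min e (z - x)) \<partial>N) + c * e powr (a + 1) / (a + 1)"
    using R by (simp add: ennreal_plus[symmetric] integral_nonneg_AE del: ennreal_plus)
qed

section \<open>Modulus of continuity of the gamma distribution function\<close>

lemma cdf_diff_le_density:
  fixes f b :: "real \<Rightarrow> real"
  assumes N: "prob_space N" "N = density lborel (\<lambda>x. ennreal (f x))"
    and [measurable]: "f \<in> borel_measurable borel" and s: "s \<ge> 0"
    and le: "\<And>t. 0 < t \<Longrightarrow> t \<le> s \<Longrightarrow> f (x + t) \<le> b t"
    and b: "\<And>t. 0 \<le> t \<Longrightarrow> b t \<ge> 0" "(b has_integral B) {0..s}"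
  shows "cdf N (x + s) \<le> cdf N x + B"
proof (cases "s = 0")
  case True
  thus ?thesis using has_integral_nonneg[OF b(2)] b(1) by simp
next
  case False
  interpret N: prob_space N by fact
  have sets: "sets N = sets borel" by (simp add: N(2))
  interpret N: finite_borel_measure N by unfold_locales (simp add: sets)
  \<comment> \<open>The increment is the mass of an interval without its left end, so
    \<open>le\<close> for t > 0 suffices; this leaves room for a density that is unbounded at
    x.\<close>
  have "ennreal (cdf N (x + s) - cdf N x) = emeasure N {x<..x + s}"
    using s False by (simp add: N.cdf_diff_eq N.emeasure_eq_measure)
  also have "\<dots> = (\<integral>\<^sup>+y. ennreal (f y) * indicator {x<..x + s} y \<partial>lborel)"
    by (simp add: N(2) emeasure_density)
  also have "\<dots> = (\<integral>\<^sup>+t. ennreal (f (x + t)) * indicator {x<..x + s} (x + t) \<partial>lborel)"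
    by (subst nn_integral_real_affine[where c = 1 and t = x]) auto
  also have "\<dots> \<le> (\<integral>\<^sup>+t. ennreal (b t) * indicator {0..s} t \<partial>lborel)"
    by (intro nn_integral_mono) (auto simp: indicator_def intro!: ennreal_leI le)
  also have "\<dots> = ennreal B"
    by (rule nn_integral_has_integral_lebesgue'[OF _ b(2)]) (use b(1) in auto)
  finally show ?thesis using has_integral_nonneg[OF b(2)] b(1)
    by (subst (asm) ennreal_le_iff) auto
qed

text \<open>With m = r - 1, the inequality ln y \<le> y - 1 at y = x / m shows that m ln x - x is
  largest at x = m. For r = 1 the convention 0^0 = 1 gives the bound 1.\<close>

lemma gamma_density_le_mode:
  assumes "r \<ge> 1"
  shows "gamma_density r 1 x \<le> rpow ((r - 1) / exp 1) (r - 1) / Gamma r"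
proof (cases "x > 0")
  case False
  thus ?thesis using assms by (simp add: gamma_density_nonpos rpow_def)
next
  case True
  have "x powr (r - 1) * exp (- x) \<le> rpow ((r - 1) / exp 1) (r - 1)"
  proof (cases "r = 1")
    case False
    define m where "m = r - 1"
    have m: "m > 0" using assms False by (simp add: m_def)
    have "ln (x / m) \<le> x / m - 1" using True m by (intro ln_le_minus_one) simp
    hence "m * (ln x - ln m) \<le> m * (x / m - 1)"
      using True m by (intro mult_left_mono) (auto simp: ln_div)
    hence "m * ln x - x \<le> m * (ln m - 1)" using m by (simp add: algebra_simps)
    hence "exp (m * ln x - x) \<le> exp (m * (ln m - 1))" by simp
    moreover have "ln (m / exp 1) = ln m - 1" using m by (simp add: ln_div)
    ultimately have "x powr m * exp (- x) \<le> (m / exp 1) powr m"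
      using m True by (simp add: powr_def exp_diff exp_minus divide_inverse)
    thus ?thesis using m by (simp add: rpow_def m_def)
  qed (use True in \<open>simp add: rpow_def\<close>)
  thus ?thesis using assms True by (simp add: gamma_density_eq divide_right_mono)
qed

lemma gamma_cdf_modulus_ge_1:
  assumes r: "r \<ge> 1" and s: "s \<ge> 0"
  defines "C \<equiv> rpow ((r - 1) / exp 1) (r - 1) / Gamma r"
  shows "cdf (gamma_distribution r 1) (x + s) \<le> cdf (gamma_distribution r 1) x + C * s"
proof (rule cdf_diff_le_density[OF prob_space_gamma_distribution gamma_distribution_def])
  have "((\<lambda>t. C) has_integral (s - 0) * C) {0..s}"
    using s has_integral_const_real[of C 0 s] by simp
  thus "((\<lambda>t. C) has_integral C * s) {0..s}" by (simp add: mult.commute)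
  show "C \<ge> 0" using r by (auto simp: C_def rpow_def)
qed (use r s gamma_density_le_mode in \<open>auto simp: C_def\<close>)

text \<open>For r \<le> 1 the density decreases on the positive axis, so an interval of given length
  has most mass when it starts at 0, and dropping the exponential there gives the stated term. An
  interval that starts below 0 loses its negative part and reduces to this case.\<close>

lemma gamma_cdf_modulus_le_1:
  assumes r: "0 < r" "r \<le> 1" and s: "s \<ge> 0"
  shows "cdf (gamma_distribution r 1) (x + s) \<le>
           cdf (gamma_distribution r 1) x + 1 / (r * Gamma r) * s powr r"
proof -
  let ?N = "gamma_distribution r 1"
  interpret N: prob_space ?N by (rule prob_space_gamma_distribution[OF r(1)])
  have G: "Gamma r > 0" using r by (simp add: Gamma_real_pos)
  have pos: "cdf ?N (x + s) \<le> cdf ?N x + 1 / (r * Gamma r) * s powr r"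
    if x: "x \<ge> 0" and s: "s \<ge> 0" for x s
  proof (rule cdf_diff_le_density[OF N.prob_space_axioms gamma_distribution_def])
    have "((\<lambda>t. t powr (r - 1) / Gamma r) has_integral (s powr (r - 1 + 1) / (r - 1 + 1)) / Gamma r) {0..s}"
      using r s by (intro has_integral_divide has_integral_powr_from_0) auto
    thus "((\<lambda>t. t powr (r - 1) / Gamma r) has_integral 1 / (r * Gamma r) * s powr r) {0..s}"
      by simp
    fix t assume t: "0 < t" "t \<le> s"
    have "(x + t) powr (r - 1) * exp (- (x + t)) \<le> t powr (r - 1) * 1"
      using x t r by (intro mult_mono powr_mono2') auto
    thus "gamma_density r 1 (x + t) \<le> t powr (r - 1) / Gamma r"
      using x t G by (simp add: gamma_density_eq divide_right_mono)
  qed (use G s in auto)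
  show ?thesis
  proof (cases "x \<ge> 0")
    case True
    thus ?thesis using pos s by simp
  next
    case False
    have nonpos: "cdf ?N y = 0" if "y \<le> 0" for y
    proof -
      have "emeasure ?N {..y} = integral\<^sup>N lborel (\<lambda>x::real. 0)"
        unfolding gamma_distribution_def
        by (subst emeasure_density, simp, simp, intro nn_integral_cong)
           (use that in \<open>auto simp: indicator_def gamma_density_nonpos\<close>)
      thus ?thesis by (simp add: cdf_def measure_def)
    qed
    have ge: "0 \<le> 1 / (r * Gamma r) * s powr r" using r G by simp
    show ?thesis
    proof (cases "x + s \<le> 0")
      case True
      thus ?thesis using ge False by (simp add: nonpos)
    next
      case xs: False
      have "cdf ?N (0 + (x + s)) \<le> cdf ?N 0 + 1 / (r * Gamma r) * (x + s) powr r"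
        using xs by (intro pos) auto
      also have "\<dots> \<le> 0 + 1 / (r * Gamma r) * s powr r"
        using r G False xs s by (intro add_mono mult_left_mono powr_mono2) (auto simp: nonpos)
      finally show ?thesis using False by (simp add: nonpos)
    qed
  qed
qed

context neg_binomial_law
begin

text \<open>The ramps have height e and slope -1, so that \<open>lipschitz_bound\<close> applies
  unscaled; division by e comes last. The ramp ending at z + e dominates e times the indicator of x
  \<le> z, and the one ending at z is dominated by it.\<close>

lemma kolmogorov_bound:
  assumes e: "e > 0" and a: "a > 0" and c: "c \<ge> 0"
    and modulus: "\<And>x s. s \<ge> 0 \<Longrightarrow>
      cdf (gamma_distribution r 1) (x + s) \<le> cdf (gamma_distribution r 1) x + c * s powr a"
  shows "kolmogorov_dist (distr M borel W) (gamma_distribution r 1) \<le>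
           ereal (c * e powr a / (a + 1) + 4 * p * pos_prob / e)"
  unfolding kolmogorov_dist_def
proof (rule SUP_least, unfold ereal_less_eq)
  fix z :: real
  let ?N = "gamma_distribution r 1" and ?P = "distr M borel W"
  interpret P: prob_space ?P by (rule prob_space_distr) simp
  define \<phi> where "\<phi> t x = max 0 (min e (t - x))" for t x :: real
  have lip: "1-lipschitz_on UNIV (\<phi> t)" for t
    by (rule lipschitz_onI) (auto simp: \<phi>_def dist_real_def)
  note int = lipschitz_integrable[OF lipschitz_1_abs[OF lip]]
  have step: "(\<integral>x. e * indicator {..z} x \<partial>?P) = e * cdf ?P z" by (simp add: cdf_def)
  have ind_int: "integrable ?P (\<lambda>x. e * indicator {..z} x)"
    by (rule P.integrable_const_bound[where B = e]) (use e in \<open>auto simp: indicator_def\<close>)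
  have "e * cdf ?P z \<le> (\<integral>x. \<phi> (z + e) x \<partial>?P)"
    unfolding step[symmetric]
    by (intro integral_mono int ind_int) (use e in \<open>auto simp: \<phi>_def indicator_def\<close>)
  also have "\<dots> \<le> (\<integral>x. \<phi> (z + e) x \<partial>?N) + 4 * p * pos_prob"
    using lipschitz_bound[OF lip, of "z + e"] by linarith
  also have "(\<integral>x. \<phi> (z + e) x \<partial>?N) \<le> e * cdf ?N z + c * e powr (a + 1) / (a + 1)"
    unfolding \<phi>_def using modulus
    by (intro smoothing_cdf prob_space_gamma_distribution r_pos e a c) auto
  finally have upper: "e * cdf ?P z \<le> e * cdf ?N z + c * e powr (a + 1) / (a + 1) + 4 * p * pos_prob"
    by simp
  have "e * cdf ?N z \<le> (\<integral>x. \<phi> z x \<partial>?N) + c * e powr (a + 1) / (a + 1)"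
    unfolding \<phi>_def using modulus
    by (intro smoothing_cdf prob_space_gamma_distribution r_pos e a c) auto
  also have "(\<integral>x. \<phi> z x \<partial>?N) \<le> (\<integral>x. \<phi> z x \<partial>?P) + 4 * p * pos_prob"
    using lipschitz_bound[OF lip, of z] by linarith
  also have "(\<integral>x. \<phi> z x \<partial>?P) \<le> e * cdf ?P z"
    unfolding step[symmetric]
    by (intro integral_mono int ind_int) (use e in \<open>auto simp: \<phi>_def indicator_def\<close>)
  finally have lower: "e * cdf ?N z \<le> e * cdf ?P z + c * e powr (a + 1) / (a + 1) + 4 * p * pos_prob"
    by simp
  have "e * \<bar>cdf ?P z - cdf ?N z\<bar> \<le> c * e powr (a + 1) / (a + 1) + 4 * p * pos_prob"
    using upper lower e by (simp add: abs_if algebra_simps)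
  also have "\<dots> = e * (c * e powr a / (a + 1) + 4 * p * pos_prob / e)"
    using e by (simp add: distrib_left powr_add mult_ac)
  finally show "\<bar>cdf ?P z - cdf ?N z\<bar> \<le> c * e powr a / (a + 1) + 4 * p * pos_prob / e"
    using e by (subst (asm) mult_le_cancel_left_pos)
qed

text \<open>Disposes of smoothing widths e \<ge> 1, for which the claimed bound is at least
  1.\<close>

lemma kolmogorov_le_1: "kolmogorov_dist (distr M borel W) (gamma_distribution r 1) \<le> 1"
  unfolding kolmogorov_dist_def
proof (rule SUP_least)
  fix z :: real
  interpret P: prob_space "distr M borel W" by (rule prob_space_distr) simp
  interpret N: prob_space "gamma_distribution r 1" by (rule prob_space_gamma_distribution[OF r_pos])
  have "\<bar>cdf (distr M borel W) z - cdf (gamma_distribution r 1) z\<bar> \<le> 1"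
    using P.prob_le_1[of "{..z}"] N.prob_le_1[of "{..z}"]
      measure_nonneg[of "distr M borel W" "{..z}"] measure_nonneg[of "gamma_distribution r 1" "{..z}"]
    by (simp only: cdf_def abs_le_iff) linarith
  thus "ereal \<bar>cdf (distr M borel W) z - cdf (gamma_distribution r 1) z\<bar> \<le> 1"
    by (simp add: one_ereal_def)
qed

end

section \<open>The explicit constants\<close>

text \<open>Log-convexity between the points 1 and 2, where Gamma has the value 1. It serves to
  bound r Gamma(r) = Gamma(1 + r).\<close>

lemma Gamma_le_1:
  assumes "0 \<le> x" "x \<le> (1 :: real)"
  shows "Gamma (1 + x) \<le> 1"
proof -
  have "(ln \<circ> Gamma) ((1 - x) *\<^sub>R 1 + x *\<^sub>R 2) \<le>
      (1 - x) * (ln \<circ> Gamma) 1 + x * (ln \<circ> Gamma) (2 :: real)"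
    using assms by (intro convex_onD[OF log_convex_Gamma_real]) auto
  moreover have "Gamma (2 :: real) = 1" using Gamma_numeral[of "num.Bit0 num.One"] by simp
  ultimately have "ln (Gamma (1 + x)) \<le> 0" by (simp add: algebra_simps)
  thus ?thesis using assms Gamma_real_pos[of "1 + x"] by simp
qed

lemma ln_12_le: "ln 12 \<le> (29 / 10 :: real)"
proof -
  have "12 \<le> (129 / 100 :: real) ^ 10" by (simp add: power_divide)
  also have "\<dots> \<le> exp (29 / 100) ^ 10"
    using exp_ge_add_one_self[of "29 / 100"] by (intro power_mono) auto
  also have "\<dots> = exp (29 / 10)" by (simp add: exp_of_nat_mult[symmetric])
  finally have "ln 12 \<le> ln (exp (29 / 10 :: real))" by (intro ln_mono) auto
  thus ?thesis by simp
qed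

text \<open>Applied with s = r + 2 and r < 1/3, hence 7/3. The constant 16/5 lies above 12/11 *
  29/10, which the case p \<ge> 1/12 requires, and below 45/14, the value of 3 (r + 3) / ((r + 1) (r
  + 2)) at r = 1/3, which the application allows.\<close>

lemma neg_ln_le:
  fixes e p s :: real
  assumes e: "0 < e" "e \<le> 1" and p: "0 < p" "p < 1" and s: "s \<le> 7 / 3"
    and le: "e powr s \<le> 12 * p"
  shows "- ln p \<le> (1 - p) * (16 / 5 / e)"
proof (cases "p \<ge> 1 / 12")
  case True
  \<comment> \<open>The weight with p = (1 - t) / 12 + t; concavity puts ln above its chord over
    [1/12, 1].\<close>
  define t where "t = (12 * p - 1) / 11"
  have "(1 - t) * ln (1 / 12) + t * ln 1 \<le> ln ((1 - t) *\<^sub>R (1 / 12) + t *\<^sub>R 1)"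
    using p True by (intro concave_onD[OF ln_concave]) (auto simp: t_def)
  also have "(1 - t) *\<^sub>R (1 / 12) + t *\<^sub>R 1 = p" by (simp add: t_def field_simps)
  finally have "- ln p \<le> (1 - t) * ln 12" by (simp add: ln_div)
  also have "\<dots> \<le> (1 - t) * (29 / 10)"
    using p ln_12_le by (intro mult_left_mono) (auto simp: t_def)
  also have "\<dots> = (1 - p) * (12 / 11 * (29 / 10))" by (simp add: t_def field_simps)
  also have "\<dots> \<le> (1 - p) * (16 / 5 / e)"
    using p e by (intro mult_left_mono) (auto simp: field_simps)
  finally show ?thesis .
next
  case False
  \<comment> \<open>The hypothesis bounds - ln p by ln 12 - s ln e, and - ln e \<le> 1 / e - 1 turns
    this into a multiple of 1 / e. In this case 1 - p exceeds 11/12.\<close>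
  have "s * ln e = ln (e powr s)" using e by simp
  also have "\<dots> \<le> ln (12 * p)" using le e by (intro ln_mono) auto
  finally have "s * ln e \<le> ln (12 * p)" .
  moreover have "ln (12 * p) = ln 12 + ln p" using p by (simp add: ln_mult)
  moreover have "s * ln e \<ge> 7 / 3 * ln e"
    using s e by (intro mult_right_mono_neg) auto
  moreover have "- ln e \<le> 1 / e - 1"
    using ln_le_minus_one[of "1 / e"] e by (simp add: ln_div)
  from mult_left_mono[OF this, of "7 / 3"] have "7 / 3 * (- ln e) \<le> 7 / 3 * (1 / e - 1)" by simp
  ultimately have "- ln p \<le> 29 / 10 + 7 / 3 * (1 / e - 1)"
    using ln_12_le by (smt (verit) mult_minus_right)
  also have "\<dots> \<le> 11 / 12 * (16 / 5 / e)"
    using e by (simp add: field_simps)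
  also have "\<dots> \<le> (1 - p) * (16 / 5 / e)"
    using False e by (intro mult_right_mono) auto
  finally show ?thesis .
qed

context neg_binomial_law
begin

text \<open>It suffices that p^2 P(T \<ge> 1)^2 \<le> 6 r p / (r + 2). For r \<le> 4 this follows
  from P^2 \<le> P \<le> r / p, as 6 / (r + 2) \<ge> 1; for r > 4 from P \<le> 1, as then 6 r \<ge>
  r + 2.\<close>

lemma wasserstein_constants:
  "4 * p * pos_prob \<le> 4 * sqrt (6 * r * p / (r + 2)) + 4 * r * p / (r + 2)"
proof -
  have "p * pos_prob \<le> sqrt (6 * r * p / (r + 2))"
  proof (rule real_le_rsqrt)
    have P2: "pos_prob\<^sup>2 \<le> pos_prob"
      using pos_prob_bounds by (simp add: power2_eq_square mult_left_le)
    have "p\<^sup>2 * pos_prob\<^sup>2 \<le> 6 * r * p / (r + 2)"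
    proof (cases "r \<le> 4")
      case True
      have "p\<^sup>2 * pos_prob\<^sup>2 \<le> p\<^sup>2 * (r / p)"
        using P2 pos_prob_bounds by (intro mult_left_mono) auto
      also have "\<dots> = r * p" using p by (simp add: power2_eq_square)
      also have "\<dots> \<le> r * p * (6 / (r + 2))"
        using mult_left_mono[of 1 "6 / (r + 2)" "r * p"] True r_pos p by simp
      finally show ?thesis by (simp add: mult_ac)
    next
      case False
      have "p\<^sup>2 * pos_prob\<^sup>2 \<le> p * 1"
        using order_trans[OF P2 pos_prob_bounds(2)] p
        by (intro mult_mono) (auto simp: power2_eq_square mult_left_le)
      also have "\<dots> \<le> p * (6 * r / (r + 2))"
        using False p by (intro mult_left_mono) auto
      finally show ?thesis by (simp add: mult_ac)
    qed
    thus "(p * pos_prob)\<^sup>2 \<le> 6 * r * p / (r + 2)" by (simp add: power_mult_distrib)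
  qed
  moreover have "0 \<le> 4 * r * p / (r + 2)" using r_pos p by simp
  ultimately show ?thesis by linarith
qed

lemma kolmogorov_ge_1:
  assumes r: "r \<ge> 1"
  shows "kolmogorov_dist (distr M borel W) (gamma_distribution r 1) \<le>
    ereal (a_coef r r 1 * (p / 2) powr (1 / 3) + b_coef r r 1 * (p / 2) powr (2 / 3))"
proof -
  define C where "C = rpow ((r - 1) / exp 1) (r - 1) / Gamma r"
  define m where "m = r / (r + 2)"
  define u where "u = a_coef r r 1 * (p / 2) powr (1 / 3)"
  define v where "v = b_coef r r 1 * (p / 2) powr (2 / 3)"
  have m: "m > 0" "3 * m \<ge> 1" using r by (auto simp: m_def field_simps)
  have C: "C > 0" using r Gamma_real_pos[of r] by (auto simp: C_def rpow_def)
  have u: "u = 3 * (6 powr (1/3) * m powr (1/3)) * C powr (2/3) * (p / 2) powr (1/3)"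
    using r m C by (simp add: u_def a_coef_def m_def C_def powr_mult[symmetric])
  have "1 / (6 * Gamma r) * rpow ((r - 1) / exp 1) (r - 1) = C / 6" by (simp add: C_def)
  moreover have "b_coef r r 1 =
      4 * m powr (2/3) * (1 / (6 * Gamma r) * rpow ((r - 1) / exp 1) (r - 1)) powr (1/3)"
    using r unfolding b_coef_def m_def by simp
  ultimately have "b_coef r r 1 = 4 * m powr (2/3) * (C / 6) powr (1/3)" by (simp only:)
  hence v: "v = 4 * m powr (2/3) * (C powr (1/3) / 6 powr (1/3)) * (p / 2) powr (2/3)"
    using C by (simp add: v_def powr_divide)
  have 1: "x powr (1/3) * x powr (2/3) = x" if "x > 0" for x :: real
    using that by (simp add: powr_add[symmetric])
  have "u * v = 12 * (m powr (1/3) * m powr (2/3)) * (C powr (1/3) * C powr (2/3)) *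
      ((p / 2) powr (1/3) * (p / 2) powr (2/3))"
    unfolding u v by simp
  also have "\<dots> = 6 * m * p * C" using m C p by (simp add: 1)
  finally have uv: "u * v = 6 * m * p * C" .
  have pos: "u > 0" "v > 0" unfolding u v using m C p by simp_all
  \<comment> \<open>The width for which the modulus term C e / 2 is half of the target u + v. The
    other half must absorb 4 p / e, where 4 p \<le> 12 m p because r \<ge> 1 gives 3 m \<ge> 1. With
    u v = 6 m p C, the quotient 12 m p / e is the harmonic mean of u and v.\<close>
  define e where "e = (u + v) / C"
  have e: "e > 0" using pos C by (simp add: e_def)
  have "kolmogorov_dist (distr M borel W) (gamma_distribution r 1) \<le>
      ereal (C * e powr 1 / (1 + 1) + 4 * p * pos_prob / e)"
    using gamma_cdf_modulus_ge_1[OF r] C e unfolding C_def[symmetric]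
    by (intro kolmogorov_bound) auto
  also have "C * e powr 1 / (1 + 1) + 4 * p * pos_prob / e \<le> u + v"
  proof -
    have "4 * p * pos_prob \<le> 12 * m * p"
      using mult_mono[of pos_prob 1 1 "3 * m"] pos_prob_bounds m p by simp
    hence "4 * p * pos_prob / e \<le> 12 * m * p / e" using e by (intro divide_right_mono) auto
    also have "12 * m * p / e = 2 * (u * v) / (u + v)" unfolding uv by (simp add: e_def)
    also have "\<dots> \<le> (u + v) / 2"
    proof -
      have "0 \<le> (u - v)\<^sup>2" by simp
      hence "2 * (u * v) * 2 \<le> (u + v) * (u + v)" by (simp add: power2_eq_square algebra_simps)
      thus ?thesis using pos by (simp add: pos_divide_le_eq)
    qed
    finally have "4 * p * pos_prob / e \<le> (u + v) / 2" .
    moreover have "C * e powr 1 / (1 + 1) \<le> (u + v) / 2" using C e pos by (simp add: e_def)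
    ultimately have "C * e powr 1 / (1 + 1) + 4 * p * pos_prob / e \<le> (u + v) / 2 + (u + v) / 2"
      by (rule add_mono[rotated])
    thus ?thesis by (simp only: field_sum_of_halves)
  qed
  finally show ?thesis by (simp add: u_def v_def)
qed

lemma kolmogorov_less_1:
  assumes r1: "r < 1"
  shows "kolmogorov_dist (distr M borel W) (gamma_distribution r 1) \<le>
    ereal (a_coef r r 1 * (p / 2) powr (r / (r + 2)) + b_coef r r 1 * (p / 2) powr ((r + 1) / (r + 2)))"
proof -
  define m where "m = r / (r + 2)"
  define g where "g = Gamma r"
  \<comment> \<open>The minimiser of e^r / (r g) + 12 m p / e^2. The minimum is (1/2 + 1/r)
    \<open>A\<close>, the first term of the claim, and 4 m p / e is the second; this explains the 24
    and the factor 1/2 + 1/r.\<close>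
  define e where "e = (24 * m * p * g) powr (1 / (r + 2))"
  define A where "A = e powr r / g"
  have m: "m > 0" using r_pos by (simp add: m_def)
  have g: "g > 0" using r_pos by (simp add: g_def Gamma_real_pos)
  have e: "e > 0" using m g p by (simp add: e_def)
  have e_powr: "e powr (r + 2) = 24 * m * p * g"
    using m g p r_pos by (simp add: e_def powr_powr)
  hence A: "A = 24 * m * p / e\<^sup>2"
    using e g by (simp add: A_def powr_add field_simps powr_numeral)
  have rg: "r * g \<le> 1"
  proof -
    have "Gamma (1 + r) = r * g"
      unfolding g_def using r_pos Gamma_plus1[of r] by (force elim!: nonpos_Ints_cases simp: add.commute)
    thus ?thesis using Gamma_le_1[of r] r_pos r1 by simp
  qed
  have "a_coef r r 1 = (1 / 2 + 1 / r) * (48 * m) powr (r / (r + 2)) * (1 / g) powr (2 / (r + 2))"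
    using r1 unfolding a_coef_def m_def g_def by simp
  moreover have "(48 * m * (p / 2)) powr (r / (r + 2)) = (48 * m) powr (r / (r + 2)) * (p / 2) powr (r / (r + 2))"
    by (rule powr_mult)
  ultimately have "a_coef r r 1 * (p / 2) powr (r / (r + 2)) =
      (1 / 2 + 1 / r) * (((48 * m) * (p / 2)) powr (r / (r + 2)) * (1 / g) powr (2 / (r + 2)))"
    by (simp only: mult_ac)
  also have "((48 * m) * (p / 2)) powr (r / (r + 2)) * (1 / g) powr (2 / (r + 2)) = A"
  proof -
    have "e powr r = (24 * m * p * g) powr (r / (r + 2))"
      by (simp add: e_def powr_powr)
    also have "\<dots> = ((48 * m) * (p / 2)) powr (r / (r + 2)) * g powr (r / (r + 2))"
      by (simp add: powr_mult[symmetric] mult.assoc)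
    also have "r / (r + 2) = 1 - 2 / (r + 2)" using r_pos by (simp add: field_simps)
    also have "g powr (1 - 2 / (r + 2)) = g * (1 / g) powr (2 / (r + 2))"
      using g by (simp add: powr_diff powr_divide)
    finally show ?thesis using g r_pos by (simp add: A_def diff_divide_eq_iff)
  qed
  finally have a_term: "a_coef r r 1 * (p / 2) powr (r / (r + 2)) = (1 / 2 + 1 / r) * A" .
  have "b_coef r r 1 = 8 * m powr ((r + 1) / (r + 2)) * (1 / (48 * g)) powr (1 / (r + 2))"
    using r1 unfolding b_coef_def m_def g_def by simp
  moreover have "(m * (p / 2)) powr ((r + 1) / (r + 2)) = m powr ((r + 1) / (r + 2)) * (p / 2) powr ((r + 1) / (r + 2))"
    by (rule powr_mult)
  ultimately have "b_coef r r 1 * (p / 2) powr ((r + 1) / (r + 2)) =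
      8 * (m * (p / 2)) powr ((r + 1) / (r + 2)) * (1 / (48 * g)) powr (1 / (r + 2))"
    by (simp only: mult_ac)
  also have expo: "(r + 1) / (r + 2) = 1 - 1 / (r + 2)" using r_pos by (simp add: field_simps)
  also have "8 * (m * (p / 2)) powr (1 - 1 / (r + 2)) * (1 / (48 * g)) powr (1 / (r + 2)) =
      8 * (m * (p / 2)) / ((m * (p / 2)) powr (1 / (r + 2)) * (48 * g) powr (1 / (r + 2)))"
    using m p g by (simp add: powr_diff powr_divide)
  also have "(m * (p / 2)) powr (1 / (r + 2)) * (48 * g) powr (1 / (r + 2)) = e"
    using m p g by (simp add: e_def powr_mult[symmetric] mult_ac)
  finally have b_term: "b_coef r r 1 * (p / 2) powr ((r + 1) / (r + 2)) = 4 * m * p / e"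
    by (simp add: expo mult.assoc)
  have A_pos: "A > 0" using e g by (simp add: A_def)
  have b_pos: "4 * m * p / e > 0" using e m p by simp
  have "kolmogorov_dist (distr M borel W) (gamma_distribution r 1) \<le>
      ereal ((1 / 2 + 1 / r) * A + 4 * m * p / e)"
  proof (cases "e \<ge> 1")
    case True
    have "1 \<le> e powr r / (r * g)"
      using ge_one_powr_ge_zero[OF True, of r] rg r_pos g by simp
    also have "\<dots> = 1 / r * A" by (simp add: A_def)
    also have "\<dots> \<le> (1 / 2 + 1 / r) * A" using A_pos by (intro mult_right_mono) auto
    finally have "1 \<le> (1 / 2 + 1 / r) * A + 4 * m * p / e" using b_pos by linarith
    thus ?thesis using kolmogorov_le_1 by (metis ereal_less_eq(3) one_ereal_def order_trans)
  next
    case False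
    hence e1: "e < 1" by simp
    \<comment> \<open>The modulus term is \<open>A\<close> / (r (r + 1)) = (1/r - 1/(r + 1))
      \<open>A\<close>, which leaves (1/2 + 1/(r + 1)) \<open>A\<close> for 4 p P(T \<ge> 1) / e. As
      \<open>A\<close> = 24 m p / e^2, that amounts to this inequality.\<close>
    have key: "pos_prob \<le> 3 * r * (r + 3) / ((r + 1) * (r + 2)) / e"
    \<comment> \<open>For r \<ge> 1/3 the right-hand side is at least 1. For smaller r its factor r
      has to be matched, which the logarithmic bound on P(T \<ge> 1) achieves.\<close>
    proof (cases "r \<ge> 1 / 3")
      case True
      have "(r + 1) * (r + 2) \<le> 3 * r * (r + 3)"
        using True mult_mono[of "1/3" r "1/3" r] by (simp add: algebra_simps)
      hence "1 \<le> 3 * r * (r + 3) / ((r + 1) * (r + 2))" using r_pos by simp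
      also have "\<dots> \<le> 3 * r * (r + 3) / ((r + 1) * (r + 2)) / e"
        using e e1 r_pos by (simp add: pos_le_divide_eq mult_left_le)
      finally show ?thesis using pos_prob_bounds by linarith
    next
      case False
      have "- ln p \<le> (1 - p) * (16 / 5 / e)"
      proof (rule neg_ln_le[where s = "r + 2"])
        have "e powr (r + 2) = 24 * p * (r * g) / (r + 2)" by (simp add: e_powr m_def)
        also have "\<dots> \<le> 24 * p * 1 / 2"
          using rg r_pos p g by (intro frac_le mult_left_mono) auto
        finally show "e powr (r + 2) \<le> 12 * p" by simp
      qed (use e e1 p False in auto)
      hence "- ln p / (1 - p) \<le> 16 / 5 / e"
        using p by (subst pos_divide_le_eq) (simp_all only: mult.commute diff_gt_0_iff_gt)
      hence "r * (- ln p / (1 - p)) \<le> r * (16 / 5 / e)" using r_pos by (intro mult_left_mono) auto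
      also have "\<dots> = r * (16 / 5) / e" by simp
      also have "\<dots> \<le> r * (3 * (r + 3) / ((r + 1) * (r + 2))) / e"
      proof (intro divide_right_mono mult_left_mono)
        have "16 * r * r \<le> 16 * (1 / 3) * (1 / 3)"
          using False r_pos by (intro mult_mono) auto
        hence "16 * ((r + 1) * (r + 2)) \<le> 5 * (3 * (r + 3))"
          using False by (simp add: algebra_simps)
        thus "16 / 5 \<le> 3 * (r + 3) / ((r + 1) * (r + 2))"
          using r_pos by (simp add: pos_le_divide_eq)
      qed (use r_pos e in auto)
      also have "r * (3 * (r + 3) / ((r + 1) * (r + 2))) / e = 3 * r * (r + 3) / ((r + 1) * (r + 2)) / e"
        by (simp only: times_divide_eq_right mult_ac)
      finally show ?thesis using pos_prob_le_ln by (rule order_trans[rotated])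
    qed
    have "kolmogorov_dist (distr M borel W) (gamma_distribution r 1) \<le>
        ereal (1 / (r * g) * e powr r / (r + 1) + 4 * p * pos_prob / e)"
      using gamma_cdf_modulus_le_1[of r] r_pos r1 g e unfolding g_def[symmetric]
      by (intro kolmogorov_bound) auto
    also have "1 / (r * g) * e powr r / (r + 1) + 4 * p * pos_prob / e \<le>
        (1 / 2 + 1 / r) * A + 4 * m * p / e"
    proof -
      have "4 * p * pos_prob / e \<le> 4 * p * (3 * r * (r + 3) / ((r + 1) * (r + 2)) / e) / e"
        using key p e by (intro divide_right_mono mult_left_mono) auto
      also have "\<dots> = (1 / 2 + 1 / (r + 1)) * A"
        using r_pos e by (simp add: A m_def divide_simps power2_eq_square) (simp add: algebra_simps)
      finally have "4 * p * pos_prob / e \<le> (1 / 2 + 1 / (r + 1)) * A" .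
      moreover have "1 / (r * g) * e powr r / (r + 1) = (1 / r - 1 / (r + 1)) * A"
        using r_pos g by (simp add: A_def diff_frac_eq)
      ultimately show ?thesis using b_pos by (simp add: ring_distribs)
    qed
    finally show ?thesis by simp
  qed
  thus ?thesis unfolding a_term b_term .
qed

end

theorem proposition4p7:
  fixes M :: "'a measure" and T :: "'a \<Rightarrow> nat" and W :: "'a \<Rightarrow> real" and \<kappa> p :: real
  assumes "prob_space M"
    and "\<kappa> > 0" and "0 < p" and "p < 1"
    and "neg_binomial_rv M T \<kappa> p"
    and "W = (\<lambda>\<omega>. p * real (T \<omega>))"
  shows "wasserstein_dist (distr M borel W) (gamma_distribution (\<kappa> * (1 - p)) 1)
           \<le> ereal (4 * sqrt (6 * \<kappa> * (1 - p) * p / (\<kappa> * (1 - p) + 2))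
                      + 4 * \<kappa> * (1 - p) * p / (\<kappa> * (1 - p) + 2)) \<and>
        (let r = \<kappa> * (1 - p); \<mu> = \<kappa> * (1 - p); \<alpha> = 1 in
         kolmogorov_dist (distr M borel W) (gamma_distribution (\<kappa> * (1 - p)) 1)
           \<le> ereal (a_coef \<mu> r \<alpha> * (0.5 * p) powr (min r 1 / (min r 1 + 2))
                      + b_coef \<mu> r \<alpha> * (0.5 * p) powr ((min r 1 + 1) / (min r 1 + 2))))"
proof -
  interpret L: neg_binomial_law M T \<kappa> p
    using assms by (simp add: neg_binomial_law_def neg_binomial_law_axioms_def)
  have r: "L.r = \<kappa> * (1 - p)" by (simp add: L.r_def)
  have W: "L.W = W" by (simp add: L.W_def assms)
  have half: "0.5 * p = p / 2" by simp
  have "wasserstein_dist (distr M borel W) (gamma_distribution L.r 1) \<le>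
      ereal (4 * sqrt (6 * L.r * p / (L.r + 2)) + 4 * L.r * p / (L.r + 2))"
    using L.wasserstein_bound L.wasserstein_constants unfolding W
    by (meson ereal_less_eq(3) order_trans)
  moreover have "kolmogorov_dist (distr M borel W) (gamma_distribution L.r 1) \<le>
      ereal (a_coef L.r L.r 1 * (p / 2) powr (min L.r 1 / (min L.r 1 + 2)) +
             b_coef L.r L.r 1 * (p / 2) powr ((min L.r 1 + 1) / (min L.r 1 + 2)))"
  proof (cases "L.r \<ge> 1")
    case True
    thus ?thesis using L.kolmogorov_ge_1 by (simp add: W)
  next
    case False
    thus ?thesis using L.kolmogorov_less_1 by (simp add: W)
  qed
  ultimately show ?thesis unfolding Let_def half r by (simp add: mult.assoc)
qed

end
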